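(* There is a randomized polynomial-time algorithm which, given an instance of \textsc{L-Sided Pricing} on a simple graph in which every vertex has capacity at least $22$, outputs a feasible solution whose expected revenue is at least $0.516$ times the optimum value of the linear program (LP-Pricing).
   Context: An instance of \textsc{L-Sided Pricing} consists of a finite bipartite graph $G=(L\cup R,E)$ (each edge joins $L$ and $R$; simple means no parallel edges), a capacity $\mu_w\in\mathbb Z_{\ge 0}\cup\{\infty\}$ for every vertex $w$, and a budget $b_e\ge 0$ for every edge $e$. A feasible solution is a pair $(p,F)$ with $p:L\cup R\to\mathbb R_{\ge0}$, $p(v)=0$ for $v\in R$, $F\subseteq E$, $p(u)+p(v)\le b_e$ for every $e=uv\in F$, and every vertex $w$ incident to at most $\mu_w$ edges of $F$; its revenue is $\sum_{e=uv\in F}(p(u)+p(v))$. For $u\in L$ let $P_u=\{b_e:e\in E\text{ incident to }u\}$ and $\delta(w)$ the set of edges incident to $w$. (LP-Pricing) has variables $y_{u,p}\ge0$ for $u\in L$, $p\in P_u$, and $x_{e,p}\ge 0$ for each edge $e=uv$ ($u\in L$) and $p\in P_u$ with $p\le b_e$; it maximizes $\sum_{e=uv}\sum_{p\in P_u}p\,x_{e,p}$ subject to: $\sum_{p\in P_u}y_{u,p}=1$ for all $u\in L$; $\sum_{e\in\delta(u)}x_{e,p}\le \mu_u\,y_{u,p}$ for all $u\in L$, $p\in P_u$; $\sum_{e=uv\in\delta(v)}\sum_{p\in P_u}x_{e,p}\le\mu_v$ for all $v\in R$; $x_{e,p}\le y_{u,p}$ for all $u\in L$, $e\in\delta(u)$,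 $p\in P_u$ with $p\le b_e$ (sums range only over defined variables). *)

theory Defs
  imports "HOL-Probability.Probability" "HOL-Library.Log_Nat"
    "HOL-Computational_Algebra.Polynomial"
begin

section \<open>L-sided pricing\<close>

text \<open>Edges are abstract objects with two end points, so parallel edges are possible.\<close>

record ('v, 'e) pricing_instance =
  lside :: "'v set"
  rside :: "'v set"
  edges :: "'e set"
  lend :: "'e \<Rightarrow> 'v"
  rend :: "'e \<Rightarrow> 'v"
  cap :: "'v \<Rightarrow> enat"
  budget :: "'e \<Rightarrow> real"

definition wf_instance :: "('v, 'e) pricing_instance \<Rightarrow> bool" where
  "wf_instance I \<longleftrightarrow>
     finite (lside I) \<and> finite (rside I) \<and> lside I \<inter> rside I = {} \<and> finite (edges I) \<and>
     (\<forall>e\<in>edges I. lend I e \<in> lside I \<and> rend I e \<in> rside I \<and> 0 \<le> budget I e)"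

definition simple_instance :: "('v, 'e) pricing_instance \<Rightarrow> bool" where
  "simple_instance I \<longleftrightarrow> inj_on (\<lambda>e. (lend I e, rend I e)) (edges I)"

definition incident :: "('v, 'e) pricing_instance \<Rightarrow> 'v \<Rightarrow> 'e set" where
  "incident I w = {e \<in> edges I. lend I e = w \<or> rend I e = w}"

definition feasible :: "('v, 'e) pricing_instance \<Rightarrow> ('v \<Rightarrow> real) \<Rightarrow> 'e set \<Rightarrow> bool" where
  "feasible I p F \<longleftrightarrow>
     (\<forall>w \<in> lside I \<union> rside I. 0 \<le> p w) \<and> (\<forall>v\<in>rside I. p v = 0) \<and> F \<subseteq> edges I \<and>
     (\<forall>e\<in>F. p (lend I e) + p (rend I e) \<le> budget I e) \<and>
     (\<forall>w \<in> lside I \<union> rside I. enat (card (F \<inter> incident I w)) \<le> cap I w)"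

definition revenue :: "('v, 'e) pricing_instance \<Rightarrow> ('v \<Rightarrow> real) \<Rightarrow> 'e set \<Rightarrow> real" where
  "revenue I p F = (\<Sum>e\<in>F. p (lend I e) + p (rend I e))"


section \<open>The linear program\<close>

definition prices :: "('v, 'e) pricing_instance \<Rightarrow> 'v \<Rightarrow> real set" where
  "prices I u = budget I ` incident I u"

text \<open>
  The prices \<open>p\<close> for which the variable \<open>x e p\<close> exists; values of \<open>x\<close> and \<open>y\<close> at
  other arguments are irrelevant.
\<close>

definition edge_prices :: "('v, 'e) pricing_instance \<Rightarrow> 'e \<Rightarrow> real set" where
  "edge_prices I e = {p \<in> prices I (lend I e). p \<le> budget I e}"

text \<open>
  For an infinite capacity the second constraint says nothing if \<open>y u p > 0\<close>; if
  \<open>y u p = 0\<close> its right-hand side is \<open>\<infinity> * 0 = 0\<close>, which the last constraint forces anyway.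
\<close>

definition lp_feasible ::
    "('v, 'e) pricing_instance \<Rightarrow> ('v \<Rightarrow> real \<Rightarrow> real) \<Rightarrow> ('e \<Rightarrow> real \<Rightarrow> real) \<Rightarrow> bool" where
  "lp_feasible I y x \<longleftrightarrow>
     (\<forall>u\<in>lside I. \<forall>p\<in>prices I u. 0 \<le> y u p) \<and>
     (\<forall>e\<in>edges I. \<forall>p\<in>edge_prices I e. 0 \<le> x e p) \<and>
     (\<forall>u\<in>lside I. (\<Sum>p\<in>prices I u. y u p) = 1) \<and>
     (\<forall>u\<in>lside I. \<forall>p\<in>prices I u.
        ereal (\<Sum>e | e \<in> incident I u \<and> p \<in> edge_prices I e. x e p)
          \<le> ereal_of_enat (cap I u) * ereal (y u p)) \<and>
     (\<forall>v\<in>rside I.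
        ereal (\<Sum>e\<in>incident I v. \<Sum>p\<in>edge_prices I e. x e p) \<le> ereal_of_enat (cap I v)) \<and>
     (\<forall>u\<in>lside I. \<forall>e\<in>incident I u. \<forall>p\<in>edge_prices I e. x e p \<le> y u p)"

definition lp_value :: "('v, 'e) pricing_instance \<Rightarrow> ('e \<Rightarrow> real \<Rightarrow> real) \<Rightarrow> real" where
  "lp_value I x = (\<Sum>e\<in>edges I. \<Sum>p\<in>edge_prices I e. p * x e p)"

text \<open>
  The supremum is taken in \<^typ>\<open>ereal\<close>, so that it is \<open>-\<infinity>\<close> if the program is infeasible;
  this happens exactly if some vertex of the left side is isolated.
\<close>

definition lp_opt :: "('v, 'e) pricing_instance \<Rightarrow> ereal" where
  "lp_opt I = (SUP (y, x) \<in> {(y, x). lp_feasible I y x}. ereal (lp_value I x))"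


section \<open>Randomized programs and their running time\<close>

text \<open>
  The machine model is a variable-free while language on binary trees with integer leaves, with
  fair coin tosses. The cost is logarithmic: every elementary operation is charged the sizes of
  its argument and result, with integers in binary. Hence running times agree with those of
  probabilistic Turing machines up to a polynomial.
\<close>

datatype val = VNil | VNum int | VPair val val

fun vsize :: "val \<Rightarrow> nat" where
  "vsize VNil = 1"
| "vsize (VNum i) = 1 + floorlog 2 (nat \<bar>i\<bar>)"
| "vsize (VPair a b) = 1 + vsize a + vsize b"

definition bool_val :: "bool \<Rightarrow> val" where
  "bool_val b = (if b then VNum 1 else VNil)"

datatype prim = Ident | Const val | First | Second | IsNum | IsPair | Add | Sub | Mul | Div | Le

fun apply_prim :: "prim \<Rightarrow> val \<Rightarrow> val" where
  "apply_prim Ident x = x"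
| "apply_prim (Const c) x = c"
| "apply_prim First (VPair a b) = a"
| "apply_prim Second (VPair a b) = b"
| "apply_prim IsNum x = bool_val (\<exists>i. x = VNum i)"
| "apply_prim IsPair x = bool_val (\<exists>a b. x = VPair a b)"
| "apply_prim Add (VPair (VNum i) (VNum j)) = VNum (i + j)"
| "apply_prim Sub (VPair (VNum i) (VNum j)) = VNum (i - j)"
| "apply_prim Mul (VPair (VNum i) (VNum j)) = VNum (i * j)"
| "apply_prim Div (VPair (VNum i) (VNum j)) = VNum (i div j)"
| "apply_prim Le (VPair (VNum i) (VNum j)) = bool_val (i \<le> j)"
| "apply_prim _ _ = VNil"

text \<open>
  A program maps a value to a value. \<open>Fork p q\<close> runs both programs on the same argument and
  pairs the results; in \<open>Cond c p q\<close> and \<open>Loop c p\<close> the test \<open>c\<close> is run on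
  the current value, and any result other than \<open>VNil\<close> counts as true.
\<close>

datatype prog =
    Prim prim
  | Coin
  | Seq prog prog
  | Fork prog prog
  | Cond prog prog prog
  | Loop prog prog

text \<open>
  \<open>exec A x r y r' t\<close>: on argument \<open>x\<close>, with \<open>r\<close> the outcomes of the coming coin
  tosses, \<open>A\<close> halts with result \<open>y\<close> at cost \<open>t\<close>, leaving the outcomes \<open>r'\<close>
  unused. There is no result if the list of outcomes runs out.
\<close>

inductive exec :: "prog \<Rightarrow> val \<Rightarrow> bool list \<Rightarrow> val \<Rightarrow> bool list \<Rightarrow> nat \<Rightarrow> bool" where
  exec_prim:
    "exec (Prim f) x r (apply_prim f x) r (1 + vsize x + vsize (apply_prim f x))"
| exec_coin:
    "exec Coin x (b # r) (bool_val b) r (1 + vsize x + vsize (bool_val b))"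
| exec_seq:
    "exec p x r y r1 t1 \<Longrightarrow> exec q y r1 z r2 t2 \<Longrightarrow> exec (Seq p q) x r z r2 (1 + t1 + t2)"
| exec_fork:
    "exec p x r y r1 t1 \<Longrightarrow> exec q x r1 z r2 t2 \<Longrightarrow>
     exec (Fork p q) x r (VPair y z) r2 (1 + vsize x + vsize (VPair y z) + t1 + t2)"
| exec_cond_true:
    "exec c x r g r1 t1 \<Longrightarrow> g \<noteq> VNil \<Longrightarrow> exec p x r1 y r2 t2 \<Longrightarrow>
     exec (Cond c p q) x r y r2 (1 + vsize x + t1 + t2)"
| exec_cond_false:
    "exec c x r VNil r1 t1 \<Longrightarrow> exec q x r1 y r2 t2 \<Longrightarrow>
     exec (Cond c p q) x r y r2 (1 + vsize x + t1 + t2)"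
| exec_loop_false:
    "exec c x r VNil r1 t1 \<Longrightarrow> exec (Loop c p) x r x r1 (1 + vsize x + t1)"
| exec_loop_true:
    "exec c x r g r1 t1 \<Longrightarrow> g \<noteq> VNil \<Longrightarrow> exec p x r1 y r2 t2 \<Longrightarrow>
     exec (Loop c p) y r2 z r3 t3 \<Longrightarrow>
     exec (Loop c p) x r z r3 (1 + vsize x + t1 + t2 + t3)"

inductive_cases exec_primE: "exec (Prim f) x r y r' t"
inductive_cases exec_coinE: "exec Coin x r y r' t"
inductive_cases exec_seqE: "exec (Seq p q) x r y r' t"
inductive_cases exec_forkE: "exec (Fork p q) x r y r' t"
inductive_cases exec_condE: "exec (Cond c p q) x r y r' t"
inductive_cases exec_loopE: "exec (Loop c p) x r y r' t"

lemma exec_deterministic: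
  assumes "exec A x r y r' t" "exec A x r z s u"
  shows "y = z \<and> r' = s \<and> t = u"
  using assms
proof (induction arbitrary: z s u rule: exec.induct)
  case exec_prim then show ?case by (auto elim: exec_primE)
next
  case exec_coin then show ?case by (auto elim: exec_coinE)
next
  case exec_seq
  from exec_seq.prems show ?case by (rule exec_seqE) (auto dest!: exec_seq.IH)
next
  case exec_fork
  from exec_fork.prems show ?case by (rule exec_forkE) (auto dest!: exec_fork.IH)
next
  case exec_cond_true
  from exec_cond_true.prems exec_cond_true.hyps show ?case
    by - (erule exec_condE; auto dest!: exec_cond_true.IH)
next
  case exec_cond_false
  from exec_cond_false.prems exec_cond_false.hyps show ?case
    by - (erule exec_condE; auto dest!: exec_cond_false.IH)
next
  case exec_loop_false
  from exec_loop_false.prems exec_loop_false.hyps show ?case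
    by - (erule exec_loopE; auto dest!: exec_loop_false.IH)
next
  case exec_loop_true
  from exec_loop_true.prems exec_loop_true.hyps show ?case
    by - (erule exec_loopE; auto dest!: exec_loop_true.IH)
qed

text \<open>
  A program that always halts at cost at most \<open>m\<close> tosses at most \<open>m\<close> coins, so
  \<open>m\<close> independent fair coins determine its output.
\<close>

definition halts_within :: "prog \<Rightarrow> val \<Rightarrow> nat \<Rightarrow> bool" where
  "halts_within A x m \<longleftrightarrow>
     (\<forall>r. length r = m \<longrightarrow> (\<exists>y r' t. exec A x r y r' t \<and> t \<le> m))"

definition output_dist :: "prog \<Rightarrow> val \<Rightarrow> nat \<Rightarrow> val pmf" where
  "output_dist A x m =
     map_pmf (\<lambda>r. THE y. \<exists>r' t. exec A x r y r' t) (pmf_of_set {r. length r = m})"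


section \<open>Encoding of instances and solutions\<close>

definition list_val :: "val list \<Rightarrow> val" where
  "list_val vs = foldr VPair vs VNil"

definition nat_val :: "nat \<Rightarrow> val" where
  "nat_val n = VNum (int n)"

definition cap_val :: "enat \<Rightarrow> val" where
  "cap_val c = (case c of enat k \<Rightarrow> nat_val k | \<infinity> \<Rightarrow> VNil)"

text \<open>
  Vertices and edges are named by arbitrary natural numbers and listed in any order; budgets
  are given as fractions of integers, and therefore rational.
\<close>

definition encodes :: "val \<Rightarrow> (nat, nat) pricing_instance \<Rightarrow> bool" where
  "encodes x I \<longleftrightarrow>
     (\<exists>us vs es (num :: nat \<Rightarrow> int) (den :: nat \<Rightarrow> int).
        distinct us \<and> set us = lside I \<and>
        distinct vs \<and> set vs = rside I \<and>
        distinct es \<and> set es = edges I \<and>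
        (\<forall>e\<in>edges I. 0 < den e \<and> budget I e = real_of_int (num e) / real_of_int (den e)) \<and>
        x = list_val
          [list_val (map (\<lambda>u. VPair (nat_val u) (cap_val (cap I u))) us),
           list_val (map (\<lambda>v. VPair (nat_val v) (cap_val (cap I v))) vs),
           list_val (map (\<lambda>e. list_val
             [nat_val e, nat_val (lend I e), nat_val (rend I e), VNum (num e), VNum (den e)]) es)])"

text \<open>
  A solution is a pair of a list of entries (vertex, (numerator, denominator)) for the prices
  and a list of edges. Vertices without an entry have price 0, and a list ends at the first
  entry that is not of the expected form, so that every value denotes some pair of a price
  function and an edge set; feasibility is required of that pair.
\<close>

fun price_list :: "val \<Rightarrow> nat \<Rightarrow> real" where
  "price_list (VPair (VPair (VNum u) (VPair (VNum a) (VNum b))) rest) w =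
     (if u = int w then real_of_int a / real_of_int b else price_list rest w)"
| "price_list _ w = 0"

fun edge_set :: "val \<Rightarrow> nat set" where
  "edge_set (VPair (VNum i) rest) = {e. int e = i} \<union> edge_set rest"
| "edge_set _ = {}"

definition sol_price :: "val \<Rightarrow> nat \<Rightarrow> real" where
  "sol_price y = price_list (apply_prim First y)"

definition sol_edges :: "val \<Rightarrow> nat set" where
  "sol_edges y = edge_set (apply_prim Second y)"

end

theory Submission
  imports Defs "HOL-Library.Multiset"
begin

text \<open>
  A deterministic greedy algorithm suffices. Call \<open>\<beta>\<close> the dual \<open>S / (2 k) + Q / (2 k\<^sup>2)\<close> of a
  right vertex of capacity \<open>k\<close>, where \<open>S\<close> is the sum of the prices \<open>w\<^sub>i\<close> of the edges
  currently sold there and \<open>Q\<close> is the sum of \<open>min w\<^sub>i w\<^sub>j\<close> over all pairs \<open>(i, j)\<close>. The left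
  vertices are treated one after the other: each takes the price \<open>w\<close> and the set of edges of
  budget at least \<open>w\<close> that maximize the sum \<open>\<alpha>\<close> of \<open>w - \<beta>\<close> over their right ends, and a right
  vertex with more than \<open>k\<close> edges gives up its cheapest one. As the graph is simple, the right
  ends are distinct, so no \<open>\<beta>\<close> changes while it is still needed. If a sale raises \<open>S\<close> by \<open>d\<close>,
  then \<open>w - \<beta>\<close> plus \<open>k\<close> times the increase of \<open>\<beta>\<close> is at most \<open>(13/8 + 1/(2 k)) d\<close>. The duals
  never decrease, so the values \<open>\<alpha>\<close> together with the final \<open>\<beta>\<close> are feasible for the dual
  program, of value at most \<open>13/8 + 1/44\<close> times the revenue, and this is less than
  \<open>1/0.516\<close>.
\<close>

section \<open>Functions computable in polynomial time\<close>

text \<open>The natural dual \<open>S / k\<close> is not good enough. If all \<open>k\<close> kept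
  prices equal the evicted price \<open>m\<close>, a sale at \<open>w\<close> gives
  \<open>(w - m) + d = 2 d\<close>, hence only half of the optimum, short of 0.516. Moving half of
  the weight to \<open>Q\<close> removes this loss: \<open>Q\<close> hardly grows when few kept
  prices exceed \<open>m\<close>, and when many do, the larger \<open>S\<close> and \<open>Q\<close>
  lower \<open>w - \<beta>\<close>. Let \<open>T\<close> be the sum of the excesses over
  \<open>m\<close>, cut off at \<open>w\<close>, and \<open>q\<close> the sum of their pairwise
  minima. Then \<open>w - m\<close> contributes \<open>d\<close>, the growth of \<open>S\<close>
  contributes \<open>d / 2\<close>, and the rest is
  \<open>(k T - q) / (2 k\<^sup>2) \<le> d / 8\<close>, the bound being governed by
  \<open>T = k d / 2\<close>; together \<open>13/8\<close>. The term \<open>d / (2 k)\<close> comes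
  from the diagonal pair of the new price and is at most \<open>d / 44\<close> for
  \<open>k \<ge> 22\<close>. Evictions do no harm on the left: they keep the prices and only lower
  the number of edges sold there. The machine knows integers only, so budgets and duals are compared
  after clearing denominators. Iterating a polynomial-time step can blow up its state, so every loop
  needs a size bound of its own.\<close>

class enc = fixes enc :: "'a \<Rightarrow> val"

instantiation int :: enc begin
definition enc_int :: "int \<Rightarrow> val" where "enc_int = VNum"
instance ..
end

instantiation enat :: enc begin
definition enc_enat :: "enat \<Rightarrow> val" where "enc_enat = cap_val"
instance ..
end

text \<open>With \<open>()\<close> encoded as \<open>VNil\<close>, a tuple that ends in
  \<open>()\<close> has the encoding of a \<open>list_val\<close> of fixed length whose entries may
  have different types. This makes the prescribed input format the encoding of a HOL type.\<close>

instantiation unit :: enc begin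
definition enc_unit :: "unit \<Rightarrow> val" where "enc_unit = (\<lambda>_. VNil)"
instance ..
end

instantiation bool :: enc begin
definition enc_bool :: "bool \<Rightarrow> val" where "enc_bool = bool_val"
instance ..
end

instantiation prod :: (enc, enc) enc begin
definition enc_prod :: "'a \<times> 'b \<Rightarrow> val" where "enc_prod p = VPair (enc (fst p)) (enc (snd p))"
instance ..
end

instantiation list :: (enc) enc begin
definition enc_list :: "'a list \<Rightarrow> val" where "enc_list xs = list_val (map enc xs)"
instance ..
end

section \<open>Sizes of encodings\<close>

lemmas enc_simps = enc_int_def enc_enat_def enc_unit_def enc_bool_def enc_prod_def

lemma enc_Nil [simp]: "enc [] = VNil"
  and enc_Cons [simp]: "enc (a # l) = VPair (enc a) (enc l)"
  by (simp_all add: enc_list_def list_val_def)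

abbreviation sz :: "'a::enc \<Rightarrow> nat" where "sz x \<equiv> vsize (enc x)"

lemma vsize_pos [simp]: "0 < vsize x"
  by (cases x) auto

lemma sz_list: "sz l = 1 + (\<Sum>a\<leftarrow>l. 1 + sz a)"
  by (induction l) auto

lemma length_le_sz: "length l \<le> sz l"
  by (induction l) auto

lemma sz_prod [simp]: "sz (a, b) = 1 + sz a + sz b"
  by (simp add: enc_simps)

lemma sz_fst: "sz (fst p) \<le> sz p" and sz_snd: "sz (snd p) \<le> sz p"
  by (cases p; simp)+

lemma sz_bool [simp]: "sz (b :: bool) \<le> 2"
  by (simp add: enc_simps bool_val_def floorlog_def)

lemma sz_append: "sz (xs @ ys) + 1 = sz xs + sz ys"
  by (induction xs) auto

text \<open>The size is a sum over the entries, so their order does not matter. This bounds the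
  results of sorting, filtering and truncating alike.\<close>

lemma sz_mset_mono:
  assumes "mset xs \<subseteq># mset ys"
  shows "sz xs \<le> sz ys"
proof -
  have "(\<Sum>a\<in>#mset xs. 1 + sz a) \<le> (\<Sum>a\<in>#mset ys. 1 + sz a)"
    using assms by (auto simp: mset_subset_eq_exists_conv)
  then show ?thesis
    unfolding sz_list by (simp flip: mset_map sum_mset_sum_list)
qed

lemma sz_take: "sz (take n xs) \<le> sz xs"
  by (rule sz_mset_mono) (metis append_take_drop_id mset_append mset_subset_eq_add_left)

lemma sz_drop: "sz (drop n xs) \<le> sz xs"
  by (rule sz_mset_mono) (metis append_take_drop_id mset_append mset_subset_eq_add_right)

section \<open>Polynomial-time functions and program constructs\<close>

lemma poly_nat_mono: "m \<le> n \<Longrightarrow> poly (P :: nat poly) m \<le> poly P n"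
  by (induction P) (auto intro!: add_mono mult_mono)

text \<open>Every result is charged for, directly or in a subrun. A time bound is therefore also a
  bound on the size of the output, which is what composition needs.\<close>

lemma exec_output_size: "exec A x r y r' t \<Longrightarrow> vsize y \<le> t"
  by (induction rule: exec.induct) auto

text \<open>The outcomes \<open>r\<close> of the coin tosses are left untouched: no coin is tossed.\<close>
definition polytime_on :: "'a::enc set \<Rightarrow> ('a \<Rightarrow> 'b::enc) \<Rightarrow> bool" where
  "polytime_on X f \<longleftrightarrow>
     (\<exists>A (P :: nat poly). \<forall>x\<in>X. \<forall>r. \<exists>t \<le> poly P (sz x). exec A (enc x) r (enc (f x)) r t)"

abbreviation polytime :: "('a::enc \<Rightarrow> 'b::enc) \<Rightarrow> bool" where
  "polytime \<equiv> polytime_on UNIV"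

lemma polytime_onI:
  assumes "\<And>x r. x \<in> X \<Longrightarrow> \<exists>t \<le> poly P (sz x). exec A (enc x) r (enc (f x)) r t"
  shows "polytime_on X f"
  using assms unfolding polytime_on_def by blast

lemma polytime_onE:
  assumes "polytime_on X f"
  obtains A P where "\<And>x r. x \<in> X \<Longrightarrow> \<exists>t \<le> poly P (sz x). exec A (enc x) r (enc (f x)) r t"
  using assms unfolding polytime_on_def by blast

lemma polytime_on_size:
  assumes "polytime_on X f"
  obtains P :: "nat poly" where "\<And>x. x \<in> X \<Longrightarrow> sz (f x) \<le> poly P (sz x)"
  using assms by (elim polytime_onE) (meson exec_output_size le_trans)

lemma polytime_on_subset: "polytime_on Y f \<Longrightarrow> X \<subseteq> Y \<Longrightarrow> polytime_on X f"
  unfolding polytime_on_def by blast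

lemma polytime_on_prim:
  assumes "\<And>x. x \<in> X \<Longrightarrow> apply_prim p (enc x) = enc (f x)"
    and "\<And>x. x \<in> X \<Longrightarrow> sz (f x) \<le> c + sz x"
  shows "polytime_on X f"
proof (rule polytime_onI [where A = "Prim p" and P = "[:1 + c, 2:]"])
  fix x r assume "x \<in> X"
  then have "exec (Prim p) (enc x) r (enc (f x)) r (1 + sz x + sz (f x))"
    using exec_prim [of p "enc x" r] assms(1) by simp
  then show "\<exists>t \<le> poly [:1 + c, 2:] (sz x). exec (Prim p) (enc x) r (enc (f x)) r t"
    using assms(2) [OF \<open>x \<in> X\<close>] by (intro exI [of _ "1 + sz x + sz (f x)"]) simp
qed

lemma polytime_on_comp:
  assumes "polytime_on X f" "polytime_on Y g" "\<And>x. x \<in> X \<Longrightarrow> f x \<in> Y"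
  shows "polytime_on X (\<lambda>x. g (f x))"
proof -
  obtain A P where A: "\<And>x r. x \<in> X \<Longrightarrow> \<exists>t \<le> poly P (sz x). exec A (enc x) r (enc (f x)) r t"
    using assms(1) by (rule polytime_onE) blast
  obtain B Q where B: "\<And>x r. x \<in> Y \<Longrightarrow> \<exists>t \<le> poly Q (sz x). exec B (enc x) r (enc (g x)) r t"
    using assms(2) by (rule polytime_onE) blast
  show ?thesis
  proof (rule polytime_onI [where A = "Seq A B" and P = "1 + P + pcompose Q P"])
    fix x r assume x: "x \<in> X"
    obtain t where t: "t \<le> poly P (sz x)" "exec A (enc x) r (enc (f x)) r t"
      using A [OF x] by blast
    obtain u where u: "u \<le> poly Q (sz (f x))" "exec B (enc (f x)) r (enc (g (f x))) r u"
      using B [OF assms(3) [OF x]] by blast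
    have "sz (f x) \<le> poly P (sz x)"
      using t exec_output_size le_trans by blast
    then have "u \<le> poly Q (poly P (sz x))"
      using u poly_nat_mono le_trans by blast
    then show "\<exists>t \<le> poly (1 + P + pcompose Q P) (sz x). exec (Seq A B) (enc x) r (enc (g (f x))) r t"
      using exec_seq [OF t(2) u(2)] t(1) by (intro exI [of _ "1 + t + u"]) (simp add: poly_pcompose)
  qed
qed

lemma polytime_on_Pair:
  assumes "polytime_on X f" "polytime_on X g"
  shows "polytime_on X (\<lambda>x. (f x, g x))"
proof -
  obtain A P where A: "\<And>x r. x \<in> X \<Longrightarrow> \<exists>t \<le> poly P (sz x). exec A (enc x) r (enc (f x)) r t"
    using assms(1) by (rule polytime_onE) blast
  obtain B Q where B: "\<And>x r. x \<in> X \<Longrightarrow> \<exists>t \<le> poly Q (sz x). exec B (enc x) r (enc (g x)) r t"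
    using assms(2) by (rule polytime_onE) blast
  show ?thesis
  proof (rule polytime_onI [where A = "Fork A B" and P = "[:2, 1:] + P + P + Q + Q"])
    fix x r assume x: "x \<in> X"
    obtain t where t: "t \<le> poly P (sz x)" "exec A (enc x) r (enc (f x)) r t"
      using A [OF x] by blast
    obtain u where u: "u \<le> poly Q (sz x)" "exec B (enc x) r (enc (g x)) r u"
      using B [OF x] by blast
    have "sz (f x) \<le> t" "sz (g x) \<le> u"
      using t u exec_output_size by blast+
    then show "\<exists>t \<le> poly ([:2, 1:] + P + P + Q + Q) (sz x).
        exec (Fork A B) (enc x) r (enc (f x, g x)) r t"
      using exec_fork [OF t(2) u(2)] t(1) u(1)
      by (intro exI [of _ "1 + sz x + (1 + sz (f x) + sz (g x)) + t + u"]) (simp add: enc_simps)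
  qed
qed

lemma polytime_on_If:
  assumes "polytime_on X c" "polytime_on {x \<in> X. c x} f" "polytime_on {x \<in> X. \<not> c x} g"
  shows "polytime_on X (\<lambda>x. if c x then f x else g x)"
proof -
  obtain C R where C: "\<And>x r. x \<in> X \<Longrightarrow> \<exists>t \<le> poly R (sz x). exec C (enc x) r (enc (c x)) r t"
    using assms(1) by (rule polytime_onE) blast
  obtain A P where A: "\<And>x r. x \<in> {x \<in> X. c x} \<Longrightarrow>
      \<exists>t \<le> poly P (sz x). exec A (enc x) r (enc (f x)) r t"
    using assms(2) by (rule polytime_onE) blast
  obtain B Q where B: "\<And>x r. x \<in> {x \<in> X. \<not> c x} \<Longrightarrow>
      \<exists>t \<le> poly Q (sz x). exec B (enc x) r (enc (g x)) r t"
    using assms(3) by (rule polytime_onE) blast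
  show ?thesis
  proof (rule polytime_onI [where A = "Cond C A B" and P = "[:1, 1:] + P + Q + R"])
    fix x r assume x: "x \<in> X"
    obtain t where t: "t \<le> poly R (sz x)" "exec C (enc x) r (bool_val (c x)) r t"
      using C [OF x] by (auto simp: enc_simps)
    show "\<exists>t \<le> poly ([:1, 1:] + P + Q + R) (sz x).
        exec (Cond C A B) (enc x) r (enc (if c x then f x else g x)) r t"
    proof (cases "c x")
      case True
      then obtain u where u: "u \<le> poly P (sz x)" "exec A (enc x) r (enc (f x)) r u"
        using A [of x r] x by blast
      show ?thesis
        using exec_cond_true [OF t(2) _ u(2)] t(1) u(1) True
        by (intro exI [of _ "1 + sz x + t + u"]) (simp add: bool_val_def)
    next
      case False
      then obtain u where u: "u \<le> poly Q (sz x)" "exec B (enc x) r (enc (g x)) r u"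
        using B [of x r] x by blast
      have "exec C (enc x) r VNil r t"
        using t(2) False by (simp add: bool_val_def)
      from exec_cond_false [OF this u(2)] show ?thesis
        using t(1) u(1) False by (intro exI [of _ "1 + sz x + t + u"]) simp
    qed
  qed
qed

text \<open>\<open>M\<close> bounds all \<open>n + 1\<close> states that are visited, so by
  monotonicity of \<open>P\<close> and \<open>Q\<close> each round costs at most
  \<open>1 + M + poly P M + poly Q M\<close>; the extra round is the final failing test.\<close>

lemma exec_Loop:
  fixes b :: "'s::enc \<Rightarrow> 's"
  assumes C: "\<And>x r. \<exists>t \<le> poly P (sz x). exec C (enc x) r (enc (c x)) r t"
    and B: "\<And>x r. c x \<Longrightarrow> \<exists>t \<le> poly Q (sz x). exec B (enc x) r (enc (b x)) r t"
    and "\<And>i. i \<le> n \<Longrightarrow> sz ((b ^^ i) x) \<le> M" "\<And>i. i < n \<Longrightarrow> c ((b ^^ i) x)" "\<not> c ((b ^^ n) x)"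
  shows "\<exists>t \<le> (n + 1) * (1 + M + poly P M + poly Q M).
    exec (Loop C B) (enc x) r (enc ((b ^^ n) x)) r t"
  using assms(3-)
proof (induction n arbitrary: x)
  case 0
  obtain t where t: "t \<le> poly P (sz x)" "exec C (enc x) r VNil r t"
    using C [of x r] 0 by (auto simp: enc_simps bool_val_def)
  have "poly P (sz x) \<le> poly P M" "sz x \<le> M"
    using 0(1) [of 0] poly_nat_mono by auto
  then show ?case
    using exec_loop_false [OF t(2), of B] t(1) by (intro exI [of _ "1 + sz x + t"]) auto
next
  case (Suc n)
  have M: "sz x \<le> M"
    using Suc.prems(1) [of 0] by simp
  obtain t where t: "t \<le> poly P (sz x)" "exec C (enc x) r (VNum 1) r t"
    using C [of x r] Suc.prems(2) [of 0] by (auto simp: enc_simps bool_val_def)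
  obtain u where u: "u \<le> poly Q (sz x)" "exec B (enc x) r (enc (b x)) r u"
    using B [of x r] Suc.prems(2) [of 0] by auto
  have "\<exists>t \<le> (n + 1) * (1 + M + poly P M + poly Q M).
      exec (Loop C B) (enc (b x)) r (enc ((b ^^ n) (b x))) r t"
    using Suc.prems(1) [of "Suc _"] Suc.prems(2) [of "Suc _"] Suc.prems(3)
    by (intro Suc.IH) (auto simp: funpow_swap1)
  then obtain v where v: "v \<le> (n + 1) * (1 + M + poly P M + poly Q M)"
      "exec (Loop C B) (enc (b x)) r (enc ((b ^^ n) (b x))) r v"
    by blast
  have "poly P (sz x) \<le> poly P M" "poly Q (sz x) \<le> poly Q M"
    using M poly_nat_mono by auto
  then have "1 + sz x + t + u + v \<le> (Suc n + 1) * (1 + M + poly P M + poly Q M)"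
    using t(1) u(1) v(1) M by simp
  then show ?case
    using exec_loop_true [OF t(2) _ u(2) v(2)] by (auto simp: funpow_swap1)
qed

section \<open>Primitive operations and folds\<close>

lemma polytime_id: "polytime_on X (\<lambda>x. x)"
  by (rule polytime_on_prim [where p = Ident and c = 0]) auto

lemma polytime_const: "polytime_on X (\<lambda>x. c)"
  by (rule polytime_on_prim [where p = "Const (enc c)" and c = "sz c"]) auto

lemma polytime_fst': "polytime_on X fst"
  by (rule polytime_on_prim [where p = First and c = 0]) (auto simp: enc_simps)

lemma polytime_snd': "polytime_on X snd"
  by (rule polytime_on_prim [where p = Second and c = 0]) (auto simp: enc_simps)

text \<open>On \<open>VNil\<close> the primitive \<open>First\<close> returns \<open>VNil\<close>,
  which in general does not encode \<open>hd []\<close>. Such partial operations are one reason why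
  \<open>polytime_on\<close> carries a domain.\<close>

lemma polytime_hd: "polytime_on {l. l \<noteq> []} hd"
  by (rule polytime_on_prim [where p = First and c = 0]) (auto simp: neq_Nil_conv)

lemma polytime_tl: "polytime_on {l. l \<noteq> []} tl"
  by (rule polytime_on_prim [where p = Second and c = 0]) (auto simp: neq_Nil_conv)

lemma polytime_nonempty: "polytime_on X (\<lambda>l. l \<noteq> [])"
proof (rule polytime_on_prim [where p = IsPair and c = 2])
  fix x :: "'a list"
  show "apply_prim IsPair (enc x) = enc (x \<noteq> [])"
    by (cases x) (auto simp: enc_simps)
qed (rule trans_le_add1, rule sz_bool)

lemma polytime_fst: "polytime_on X f \<Longrightarrow> polytime_on X (\<lambda>x. fst (f x))"
  by (rule polytime_on_comp [OF _ polytime_fst']) auto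

lemma polytime_snd: "polytime_on X f \<Longrightarrow> polytime_on X (\<lambda>x. snd (f x))"
  by (rule polytime_on_comp [OF _ polytime_snd']) auto

text \<open>The loop runs on triples of parameter, accumulator and remaining list. The bound on all
  prefixes is essential, since a polynomial-time step such as doubling the accumulator may grow it
  exponentially over the iterations.\<close>

lemma polytime_foldl_bounded:
  fixes f :: "'c::enc \<Rightarrow> 's::enc \<Rightarrow> 'a::enc \<Rightarrow> 's" and B :: "nat poly"
  assumes f: "polytime (\<lambda>q. f (fst q) (fst (snd q)) (snd (snd q)))"
    and s: "polytime s" and l: "polytime l"
    and B: "\<And>x i. sz (foldl (f x) (s x) (take i (l x))) \<le> poly B (sz x)"
  shows "polytime (\<lambda>x. foldl (f x) (s x) (l x))"
proof -
  define c :: "'c \<times> 's \<times> 'a list \<Rightarrow> bool" where "c q \<longleftrightarrow> snd (snd q) \<noteq> []" for q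
  define b :: "'c \<times> 's \<times> 'a list \<Rightarrow> 'c \<times> 's \<times> 'a list" where
    "b q = (fst q, f (fst q) (fst (snd q)) (hd (snd (snd q))), tl (snd (snd q)))" for q
  define g where "g q = (fst q, fst (snd q), hd (snd (snd q)))" for q :: "'c \<times> 's \<times> 'a list"
  have sub: "polytime_on {q. c q} (\<lambda>q. snd (snd q))"
    by (intro polytime_fst polytime_snd polytime_id)
  have "polytime_on {q. c q} g"
    unfolding g_def
    by (intro polytime_on_Pair polytime_fst polytime_snd polytime_id polytime_on_comp [OF sub polytime_hd])
      (auto simp: c_def)
  then have "polytime_on {q. c q} (\<lambda>q. f (fst (g q)) (fst (snd (g q))) (snd (snd (g q))))"
    by (rule polytime_on_comp [OF _ f]) simp
  then have "polytime_on {q. c q} b"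
    unfolding b_def g_def fst_conv snd_conv
    by (intro polytime_on_Pair polytime_fst polytime_id polytime_on_comp [OF sub polytime_tl])
      (auto simp: c_def)
  then obtain D Q where D: "\<And>q r. q \<in> {q. c q} \<Longrightarrow>
      \<exists>t \<le> poly Q (sz q). exec D (enc q) r (enc (b q)) r t"
    by (erule_tac polytime_onE) blast
  have "polytime c"
    unfolding c_def
    by (rule polytime_on_comp [OF polytime_snd polytime_nonempty]) (auto intro: polytime_snd')
  then obtain C P where C: "\<And>q r. q \<in> UNIV \<Longrightarrow> \<exists>t \<le> poly P (sz q). exec C (enc q) r (enc (c q)) r t"
    by (rule polytime_onE) blast
  obtain L where L: "\<And>x. x \<in> UNIV \<Longrightarrow> sz (l x) \<le> poly L (sz x)"
    using l by (rule polytime_on_size) blast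
  have iter: "(b ^^ i) (x, s, l) = (x, foldl (f x) s (take i l), drop i l)"
    if "i \<le> length l" for x s l i
    using that
  proof (induction i)
    case (Suc i)
    then show ?case
      by (simp add: b_def take_Suc_conv_app_nth hd_drop_conv_nth drop_Suc tl_drop)
  qed simp
  have final: "(b ^^ length l) (x, s, l) = (x, foldl (f x) s l, [])" for x s l
    by (simp add: iter)
  define N where "N = [:2, 1:] + B + L"
  define R where "R = (L + 1) * (1 + N + pcompose P N + pcompose Q N)"
  \<comment> \<open>The bound \<open>B\<close> speaks only of accumulators that arise from
    \<open>s x\<close> and \<open>l x\<close>, so the loop is analysed on these initial states
    only.\<close>
  have iterate: "polytime_on (range (\<lambda>x. (x, s x, l x))) (\<lambda>q. (b ^^ length (snd (snd q))) q)"
  proof (rule polytime_onI [where A = "Loop C D" and P = R])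
    fix q r
    assume "q \<in> range (\<lambda>x. (x, s x, l x))"
    then obtain x where q: "q = (x, s x, l x)"
      by blast
    let ?q = "(x, s x, l x)" and ?n = "length (l x)" and ?M = "poly N (sz x)"
    have M: "sz ((b ^^ i) ?q) \<le> ?M" if "i \<le> ?n" for i
      using B [of x i] L [of x] sz_drop [of i "l x"] that by (simp add: iter N_def)
    have "\<exists>t \<le> (?n + 1) * (1 + ?M + poly P ?M + poly Q ?M).
        exec (Loop C D) (enc ?q) r (enc ((b ^^ ?n) ?q)) r t"
      by (rule exec_Loop [where c = c, OF C [OF UNIV_I] D [OF CollectI]]) (use M in \<open>simp_all add: iter c_def\<close>)
    then obtain t where t: "t \<le> (?n + 1) * (1 + ?M + poly P ?M + poly Q ?M)"
      "exec (Loop C D) (enc ?q) r (enc ((b ^^ ?n) ?q)) r t"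
      by blast
    note t(1)
    also have "(?n + 1) * (1 + ?M + poly P ?M + poly Q ?M) \<le> poly R (sz x)"
      unfolding R_def poly_mult poly_add poly_1 poly_pcompose
      using length_le_sz [of "l x"] L [of x] by (intro mult_right_mono) simp_all
    also have "\<dots> \<le> poly R (sz ?q)"
      by (rule poly_nat_mono) simp
    finally show "\<exists>t \<le> poly R (sz q).
        exec (Loop C D) (enc q) r (enc ((b ^^ length (snd (snd q))) q)) r t"
      using t(2) unfolding q by auto
  qed
  have "polytime (\<lambda>x. (x, s x, l x))"
    by (intro polytime_on_Pair polytime_id s l)
  then have "polytime (\<lambda>x. (b ^^ length (snd (snd (x, s x, l x)))) (x, s x, l x))"
    by (rule polytime_on_comp [OF _ iterate]) blast
  then have "polytime (\<lambda>x. fst (snd ((b ^^ length (snd (snd (x, s x, l x)))) (x, s x, l x))))"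
    by (intro polytime_fst polytime_snd)
  then show ?thesis
    by (simp add: final)
qed

section \<open>Closure rules that follow the syntax of a term\<close>

named_theorems polytime_intros

lemmas [polytime_intros] = polytime_id polytime_const polytime_fst polytime_snd polytime_on_Pair

text \<open>Below a binder, as in \<open>map\<close> or \<open>filter\<close>, the outer variable
  turns into a component of a pair with the bound element. \<open>assms [THEN polytime_comp]\<close>
  lifts the hypotheses to such pairs.\<close>

lemma polytime_comp:
  "polytime g \<Longrightarrow> polytime_on X f \<Longrightarrow> polytime_on X (\<lambda>x. g (f x))"
  by (rule polytime_on_comp) auto

lemma polytime_comp2:
  assumes "polytime (\<lambda>q. h (fst q) (snd q))" "polytime_on X f" "polytime_on X g"
  shows "polytime_on X (\<lambda>x. h (f x) (g x))"
  using polytime_comp [OF assms(1) polytime_on_Pair [OF assms(2,3)]] by simp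

lemma polytime_if [polytime_intros]:
  "polytime c \<Longrightarrow> polytime f \<Longrightarrow> polytime g \<Longrightarrow> polytime (\<lambda>x. if c x then f x else g x)"
  by (intro polytime_on_If) (auto intro: polytime_on_subset)

lemma polytime_Not [polytime_intros]:
  assumes "polytime c"
  shows "polytime (\<lambda>x. \<not> c x)"
proof -
  have "polytime (\<lambda>x. if c x then False else True)"
    by (intro polytime_intros assms)
  moreover have "(if c x then False else True) = (\<not> c x)" for x
    by simp
  ultimately show ?thesis
    by (simp only:)
qed

lemma polytime_conj [polytime_intros]:
  assumes "polytime c" "polytime d"
  shows "polytime (\<lambda>x. c x \<and> d x)"
proof -
  have "polytime (\<lambda>x. if c x then d x else False)"
    by (intro polytime_intros assms)
  moreover have "(if c x then d x else False) = (c x \<and> d x)" for x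
    by simp
  ultimately show ?thesis
    by (simp only:)
qed

lemma polytime_Let [polytime_intros]:
  assumes "polytime g" "polytime (\<lambda>q. f (fst q) (snd q))"
  shows "polytime (\<lambda>x. let a = g x in f x a)"
  unfolding Let_def by (rule polytime_comp2 [OF assms(2) polytime_id assms(1)])

section \<open>Integer arithmetic\<close>

lemma sz_int_leI: "\<bar>i\<bar> < 2 ^ k \<Longrightarrow> sz (i :: int) \<le> 1 + k"
  by (simp add: enc_simps floorlog_le_iff nat_less_iff)

lemma int_bound_sz: "\<bar>i\<bar> < 2 ^ (sz (i :: int) - 1)"
  using floorlog_leD [of 2 "nat \<bar>i\<bar>" "floorlog 2 (nat \<bar>i\<bar>)"]
  by (simp add: enc_simps nat_less_iff)

text \<open>Each size counts one unit for the leaf besides the binary digits. The sum of two sizes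
  thus has one unit to spare, which pays for the carry.\<close>

lemma sz_add_int: "sz (i + j :: int) \<le> sz i + sz j"
proof -
  have "\<bar>i + j\<bar> < 2 ^ (sz i - 1) + 2 ^ (sz j - 1)"
    using int_bound_sz [of i] int_bound_sz [of j] by linarith
  also have "\<dots> \<le> 2 ^ (sz i + sz j - 2) + (2 :: int) ^ (sz i + sz j - 2)"
    by (intro add_mono power_increasing) (use vsize_pos [of "enc i"] vsize_pos [of "enc j"] in linarith)+
  also have "\<dots> = 2 ^ Suc (sz i + sz j - 2)"
    by simp
  finally have "sz (i + j) \<le> 1 + Suc (sz i + sz j - 2)"
    by (rule sz_int_leI)
  then show ?thesis
    using vsize_pos [of "enc i"] vsize_pos [of "enc j"] by linarith
qed

lemma sz_minus_int: "sz (- i :: int) = sz i"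
  by (simp add: enc_simps)

lemma sz_diff_int: "sz (i - j :: int) \<le> sz i + sz j"
  using sz_add_int [of i "- j"] by (simp add: sz_minus_int)

lemma sz_mult_int: "sz (i * j :: int) \<le> sz i + sz j"
proof -
  have "\<bar>i * j\<bar> < 2 ^ (sz i - 1) * 2 ^ (sz j - 1)"
    unfolding abs_mult using int_bound_sz [of i] int_bound_sz [of j] by (intro mult_strict_mono') auto
  also have "\<dots> = 2 ^ (sz i + sz j - 2)"
    unfolding power_add [symmetric] using vsize_pos [of "enc i"] vsize_pos [of "enc j"]
    by (intro arg_cong [of _ _ "(^) 2"]) linarith
  finally have "sz (i * j) \<le> 1 + (sz i + sz j - 2)"
    by (rule sz_int_leI)
  then show ?thesis
    using vsize_pos [of "enc i"] by linarith
qed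

lemma abs_div_le_abs: "\<bar>i div j :: int\<bar> \<le> \<bar>i\<bar>"
proof (cases "j = 0")
  case False
  have *: "\<bar>a div b\<bar> \<le> \<bar>a\<bar>" if b: "0 < b" for a b :: int
  proof (cases "0 \<le> a")
    case True
    then show ?thesis
      using b zdiv_mono2 [of a 1 b] by (simp add: pos_imp_zdiv_nonneg_iff)
  next
    case False
    then have "a div 1 \<le> a div b" "a div b < 0"
      using b zdiv_mono2_neg [of a 1 b] by (simp_all add: pos_imp_zdiv_neg_iff)
    then show ?thesis
      by simp
  qed
  show ?thesis
    using False * [of j i] * [of "- j" "- i"] by (cases "0 < j") auto
qed simp

lemma sz_div_int: "sz (i div j :: int) \<le> sz i"
  using sz_int_leI [of "i div j" "sz i - 1"] int_bound_sz [of i] abs_div_le_abs [of i j]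
    vsize_pos [of "enc i"] by linarith

lemma polytime_add [polytime_intros]:
  assumes "polytime f" "polytime g"
  shows "polytime (\<lambda>x. f x + g x :: int)"
proof (rule polytime_comp2 [OF polytime_on_prim assms])
  show "sz (fst q + snd q) \<le> 0 + sz q" for q :: "int \<times> int"
    using sz_add_int [of "fst q" "snd q"] by (cases q) simp
qed (auto simp: enc_simps intro: apply_prim.simps)

lemma polytime_diff [polytime_intros]:
  assumes "polytime f" "polytime g"
  shows "polytime (\<lambda>x. f x - g x :: int)"
proof (rule polytime_comp2 [OF polytime_on_prim assms])
  show "sz (fst q - snd q) \<le> 0 + sz q" for q :: "int \<times> int"
    using sz_diff_int [of "fst q" "snd q"] by (cases q) simp
qed (auto simp: enc_simps intro: apply_prim.simps)

lemma polytime_mult [polytime_intros]: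
  assumes "polytime f" "polytime g"
  shows "polytime (\<lambda>x. f x * g x :: int)"
proof (rule polytime_comp2 [OF polytime_on_prim assms])
  show "sz (fst q * snd q) \<le> 0 + sz q" for q :: "int \<times> int"
    using sz_mult_int [of "fst q" "snd q"] by (cases q) simp
qed (auto simp: enc_simps intro: apply_prim.simps)

lemma polytime_div [polytime_intros]:
  assumes "polytime f" "polytime g"
  shows "polytime (\<lambda>x. f x div g x :: int)"
proof (rule polytime_comp2 [OF polytime_on_prim assms])
  show "sz (fst q div snd q) \<le> 0 + sz q" for q :: "int \<times> int"
    using sz_div_int [of "fst q" "snd q"] by (cases q) simp
qed (auto simp: enc_simps intro: apply_prim.simps)

lemma polytime_uminus [polytime_intros]: "polytime f \<Longrightarrow> polytime (\<lambda>x. - f x :: int)"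
  using polytime_diff [OF polytime_const, of f 0] by simp

lemma polytime_le [polytime_intros]:
  assumes "polytime f" "polytime g"
  shows "polytime (\<lambda>x. f x \<le> (g x :: int))"
proof (rule polytime_comp2 [OF polytime_on_prim assms])
  show "sz (fst q \<le> snd q) \<le> 2 + sz q" for q :: "int \<times> int"
    by (rule trans_le_add1, rule sz_bool)
qed (auto simp: enc_simps intro: apply_prim.simps)

lemma polytime_less [polytime_intros]:
  "polytime f \<Longrightarrow> polytime g \<Longrightarrow> polytime (\<lambda>x. f x < (g x :: int))"
  unfolding not_le [symmetric] by (intro polytime_intros)

lemma polytime_eq [polytime_intros]:
  "polytime f \<Longrightarrow> polytime g \<Longrightarrow> polytime (\<lambda>x. f x = (g x :: int))"
  unfolding order_eq_iff by (intro polytime_intros)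

lemma polytime_min [polytime_intros]:
  "polytime f \<Longrightarrow> polytime g \<Longrightarrow> polytime (\<lambda>x. min (f x) (g x :: int))"
  unfolding min_def by (intro polytime_intros)

section \<open>List operations\<close>

lemma polytime_Cons [polytime_intros]:
  assumes "polytime f" "polytime g"
  shows "polytime (\<lambda>x. f x # g x)"
  by (rule polytime_comp2 [OF polytime_on_prim [where p = Ident and c = 0] assms])
    (auto simp: enc_prod_def)

lemma polytime_hd_nonempty:
  "polytime l \<Longrightarrow> (\<And>x. l x \<noteq> []) \<Longrightarrow> polytime (\<lambda>x. hd (l x))"
  by (rule polytime_on_comp [OF _ polytime_hd]) auto

lemma sz_member: "a \<in> set l \<Longrightarrow> sz a \<le> sz l"
  by (induction l) auto

text \<open>The increment \<open>poly Q (sz x + sz a)\<close> does not depend on the accumulator, so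
  the growth over the whole list is at most its length times a common increment. Additive growth is
  the criterion checked for all folds below.\<close>

lemma polytime_foldl:
  fixes f :: "'c::enc \<Rightarrow> 's::enc \<Rightarrow> 'a::enc \<Rightarrow> 's" and Q :: "nat poly"
  assumes f: "polytime (\<lambda>q. f (fst q) (fst (snd q)) (snd (snd q)))"
    and s: "polytime s" and l: "polytime l"
    and Q: "\<And>x s a. a \<in> set (l x) \<Longrightarrow> sz (f x s a) \<le> sz s + poly Q (sz x + sz a)"
  shows "polytime (\<lambda>x. foldl (f x) (s x) (l x))"
proof -
  obtain S where S: "\<And>x. x \<in> UNIV \<Longrightarrow> sz (s x) \<le> poly S (sz x)"
    using s by (rule polytime_on_size) blast
  obtain L where L: "\<And>x. x \<in> UNIV \<Longrightarrow> sz (l x) \<le> poly L (sz x)"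
    using l by (rule polytime_on_size) blast
  show ?thesis
  proof (rule polytime_foldl_bounded [OF f s l])
    fix x i
    have "sz (foldl (f x) t k) \<le> sz t + length k * poly Q (sz x + sz (l x))"
      if "set k \<subseteq> set (l x)" for t k
      using that
    proof (induction k arbitrary: t)
      case (Cons a k)
      have "sz (f x t a) \<le> sz t + poly Q (sz x + sz (l x))"
        using Q [of a x t] sz_member [of a "l x"] poly_nat_mono [of "sz x + sz a" "sz x + sz (l x)" Q] Cons.prems
        by simp
      moreover have "sz (foldl (f x) (f x t a) k) \<le> sz (f x t a) + length k * poly Q (sz x + sz (l x))"
        using Cons by simp
      ultimately show ?case
        by simp
    qed simp
    from this [OF set_take_subset] have "sz (foldl (f x) (s x) (take i (l x)))
        \<le> sz (s x) + length (take i (l x)) * poly Q (sz x + sz (l x))" .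
    also have "\<dots> \<le> poly S (sz x) + poly L (sz x) * poly Q (sz x + poly L (sz x))"
      using S [of x] L [of x] length_le_sz [of "l x"]
      by (intro add_mono mult_mono poly_nat_mono) auto
    also have "\<dots> = poly (S + L * pcompose Q ([:0, 1:] + L)) (sz x)"
      by (simp add: poly_pcompose)
    finally show "sz (foldl (f x) (s x) (take i (l x))) \<le> \<dots>" .
  qed
qed

lemma polytime_rev [polytime_intros]:
  assumes "polytime l"
  shows "polytime (\<lambda>x. rev (l x))"
proof -
  have "polytime (\<lambda>x. foldl (\<lambda>s a. a # s) [] (l x))"
    by (rule polytime_foldl [where Q = "[:1, 1:]"]) (intro polytime_intros assms | simp)+
  then show ?thesis
    by (simp add: foldl_conv_fold rev_conv_fold)
qed

lemma polytime_append [polytime_intros]: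
  assumes "polytime l" "polytime k"
  shows "polytime (\<lambda>x. l x @ k x)"
proof -
  have "polytime (\<lambda>x. foldl (\<lambda>s a. a # s) (k x) (rev (l x)))"
    by (rule polytime_foldl [where Q = "[:1, 1:]"]) (intro polytime_intros assms | simp)+
  moreover have "foldl (\<lambda>s a. a # s) k (rev l) = l @ k" for l k :: "'b list"
    by (induction l) auto
  ultimately show ?thesis
    by simp
qed

lemma polytime_map [polytime_intros]:
  assumes f: "polytime (\<lambda>q. f (fst q) (snd q))" and l: "polytime l"
  shows "polytime (\<lambda>x. map (f x) (l x))"
proof -
  obtain F where F: "\<And>q. q \<in> UNIV \<Longrightarrow> sz (f (fst q) (snd q)) \<le> poly F (sz q)"
    using f by (rule polytime_on_size) blast
  have "polytime (\<lambda>x. rev (foldl (\<lambda>s a. f x a # s) [] (l x)))"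
  proof (intro polytime_intros polytime_foldl [where Q = "1 + pcompose F [:1, 1:]"] polytime_comp2 [OF f] l)
    show "sz (f x a # s) \<le> sz s + poly (1 + pcompose F [:1, 1:]) (sz x + sz a)" for x a s
      using F [of "(x, a)"] by (simp add: poly_pcompose)
  qed
  moreover have "foldl (\<lambda>s a. f x a # s) s l = rev (map (f x) l) @ s" for x s l
    by (induction l arbitrary: s) auto
  ultimately show ?thesis
    by simp
qed

lemma polytime_filter [polytime_intros]:
  assumes f: "polytime (\<lambda>q. f (fst q) (snd q))" and l: "polytime l"
  shows "polytime (\<lambda>x. filter (f x) (l x))"
proof -
  have "polytime (\<lambda>x. rev (foldl (\<lambda>s a. if f x a then a # s else s) [] (l x)))"
    by (intro polytime_intros polytime_foldl [where Q = "[:1, 1:]"] polytime_comp2 [OF f] l) auto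
  moreover have "foldl (\<lambda>s a. if f x a then a # s else s) s l = rev (filter (f x) l) @ s" for x s l
    by (induction l arbitrary: s) auto
  ultimately show ?thesis
    by simp
qed

lemma polytime_sum_list [polytime_intros]:
  assumes "polytime l"
  shows "polytime (\<lambda>x. sum_list (l x) :: int)"
proof -
  have "polytime (\<lambda>x. foldl (\<lambda>s a. s + a) 0 (l x))"
  proof (intro polytime_intros assms polytime_foldl [where Q = "[:0, 1:]"])
    show "sz (s + a) \<le> sz s + poly [:0, 1:] (sz x + sz a)" for x :: 'a and s a :: int
      using sz_add_int [of s a] by simp
  qed
  moreover have "foldl (\<lambda>s a. s + a) s l = s + sum_list l" for s and l :: "int list"
    by (induction l arbitrary: s) auto
  ultimately show ?thesis
    by simp
qed

lemma polytime_prod_list [polytime_intros]: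
  assumes "polytime l"
  shows "polytime (\<lambda>x. prod_list (l x) :: int)"
proof -
  have "polytime (\<lambda>x. foldl (\<lambda>s a. s * a) 1 (l x))"
  proof (intro polytime_intros assms polytime_foldl [where Q = "[:0, 1:]"])
    show "sz (s * a) \<le> sz s + poly [:0, 1:] (sz x + sz a)" for x :: 'a and s a :: int
      using sz_mult_int [of s a] by simp
  qed
  moreover have "foldl (\<lambda>s a. s * a) s l = s * prod_list l" for s and l :: "int list"
    by (induction l arbitrary: s) auto
  ultimately show ?thesis
    by simp
qed

lemma polytime_length [polytime_intros]:
  assumes "polytime l"
  shows "polytime (\<lambda>x. int (length (l x)))"
proof -
  have "polytime (\<lambda>x. sum_list (map (\<lambda>_. 1 :: int) (l x)))"
    by (intro polytime_intros assms)
  then show ?thesis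
    by (simp add: sum_list_triv)
qed

lemma polytime_take [polytime_intros]:
  assumes "polytime k" "polytime l"
  shows "polytime (\<lambda>x. take (nat (k x)) (l x))"
proof -
  have "polytime (\<lambda>x. foldl (\<lambda>s a. if int (length s) < k x then s @ [a] else s) [] (l x))"
  proof (intro polytime_intros assms polytime_foldl [where Q = "[:2, 1:]"] polytime_comp [of k])
    show "sz (if int (length s) < k x then s @ [a] else s) \<le> sz s + poly [:2, 1:] (sz x + sz a)"
      for x and s :: "'b list" and a
      using sz_append [of s "[a]"] by simp
  qed
  moreover have "foldl (\<lambda>s a. if int (length s) < k then s @ [a] else s) [] l = take (nat k) l"
    for k and l :: "'b list"
    by (induction l rule: rev_induct) auto
  ultimately show ?thesis
    by simp
qed

text \<open>Writes insertion with filters and append, for which closure rules are available;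
  elements with an equal key stay behind the new one, as with \<open>insort_key\<close>. Sorting is
  then a fold of insertions.\<close>

lemma insort_key_conv_filter:
  "sorted (map k l) \<Longrightarrow> insort_key k a l = filter (\<lambda>b. k b < k a) l @ a # filter (\<lambda>b. \<not> k b < k a) l"
proof (induction l)
  case (Cons b l)
  show ?case
  proof (cases "k b < k a")
    case False
    then have "\<not> k c < k a" if "c \<in> set (b # l)" for c
      using that Cons.prems by fastforce
    then have "filter (\<lambda>c. k c < k a) (b # l) = []" "filter (\<lambda>c. \<not> k c < k a) (b # l) = b # l"
      by (auto simp: filter_empty_conv filter_id_conv)
    then show ?thesis
      using False by (simp only: insort_key.simps append_Nil not_less if_True)
  qed (use Cons in auto)
qed simp

lemma polytime_sort_key [polytime_intros]:
  fixes key :: "'c::enc \<Rightarrow> 'a::enc \<Rightarrow> int"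
  assumes key: "polytime (\<lambda>q. key (fst q) (snd q))" and l: "polytime l"
  shows "polytime (\<lambda>x. sort_key (key x) (l x))"
proof -
  define ins where
    "ins x s a = filter (\<lambda>b. key x b < key x a) s @ a # filter (\<lambda>b. \<not> key x b < key x a) s" for x s a
  have "polytime (\<lambda>x. foldl (ins x) [] (rev (l x)))"
  proof (intro polytime_foldl [where Q = "[:1, 1:]"])
    show "polytime (\<lambda>q. ins (fst q) (fst (snd q)) (snd (snd q)))"
      unfolding ins_def by (intro polytime_intros polytime_comp2 [OF key])
    have "mset (ins x s a) = mset (a # s)" for x s a
      using multiset_partition [of "mset s" "\<lambda>b. key x b < key x a"] by (simp add: ins_def)
    then have "sz (ins x s a) \<le> sz (a # s)" for x s a
      by (intro sz_mset_mono) simp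
    from this show "sz (ins x s a) \<le> sz s + poly [:1, 1:] (sz x + sz a)" for x s a
      by (rule order_trans) simp
  qed (intro polytime_intros l)+
  moreover have "foldl (ins x) [] (rev l) = sort_key (key x) l" for x l
  proof (induction l)
    case (Cons a l)
    then show ?case
      using insort_key_conv_filter [of "key x" "sort_key (key x) l" a]
      by (simp add: ins_def)
  qed simp
  ultimately show ?thesis
    by simp
qed

text \<open>A finite capacity has the same encoding as the integer in it, and
  \<open>\<infinity>\<close> is \<open>VNil\<close>. So \<open>IsNum\<close> is the case test and
  \<open>Ident\<close> extracts the number.\<close>

lemma polytime_enat_cases [polytime_intros]:
  assumes "polytime c" "polytime f"
  shows "polytime (\<lambda>x. case c x of enat n \<Rightarrow> int n | \<infinity> \<Rightarrow> (f x :: int))"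
proof -
  have "polytime_on UNIV (\<lambda>c :: enat. c \<noteq> \<infinity>)"
  proof (rule polytime_on_prim [where p = IsNum and c = 2])
    show "apply_prim IsNum (enc c) = enc (c \<noteq> \<infinity>)" for c :: enat
      by (cases c) (auto simp: enc_simps cap_val_def nat_val_def)
  qed (rule trans_le_add1, rule sz_bool)
  from polytime_comp [OF this assms(1)] have infinite: "polytime (\<lambda>x. c x \<noteq> \<infinity>)" .
  have "polytime_on {c :: enat. c \<noteq> \<infinity>} (\<lambda>c. int (the_enat c))"
    by (rule polytime_on_prim [where p = Ident and c = 0]) (auto simp: enc_simps cap_val_def nat_val_def)
  have "polytime_on {x \<in> UNIV. c x \<noteq> \<infinity>} (\<lambda>x. int (the_enat (c x)))"
    by (rule polytime_on_comp [OF polytime_on_subset [OF assms(1) subset_UNIV] \<open>polytime_on {c. c \<noteq> \<infinity>} _\<close>]) simp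
  from polytime_on_If [OF infinite this polytime_on_subset [OF assms(2) subset_UNIV]]
  have "polytime (\<lambda>x. if c x \<noteq> \<infinity> then int (the_enat (c x)) else f x)" .
  moreover have "(if c x \<noteq> \<infinity> then int (the_enat (c x)) else f x) = (case c x of enat n \<Rightarrow> int n | \<infinity> \<Rightarrow> f x)" for x
    by (cases "c x") auto
  ultimately show ?thesis
    by simp
qed

section \<open>The potential of a right vertex\<close>

text \<open>Ordered pairs, with the diagonal. For nonnegative prices this is the integral over all
  thresholds of the squared number of prices above the threshold. It is polymorphic because the
  program evaluates it on integers and the analysis on reals.\<close>

definition min_sum :: "'a::linordered_idom list \<Rightarrow> 'a" where
  "min_sum ws = (\<Sum>x\<leftarrow>ws. \<Sum>y\<leftarrow>ws. min x y)"

text \<open>Normalized so that \<open>k\<close> equal prices \<open>m\<close> have the dual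
  \<open>m\<close>: a full vertex gives no gain to an offer at its common price.\<close>

definition vertex_dual :: "nat \<Rightarrow> real list \<Rightarrow> real" where
  "vertex_dual k ws = (real k * sum_list ws + min_sum ws) / (2 * (real k)\<^sup>2)"

lemma sum_list_mset_cong: "mset xs = mset ys \<Longrightarrow> sum_list (map f xs) = (sum_list (map f ys) :: 'a::comm_monoid_add)"
  by (metis mset_map sum_mset_sum_list)

lemma min_sum_mset_cong: "mset xs = mset ys \<Longrightarrow> min_sum xs = min_sum ys"
  unfolding min_sum_def by (subst sum_list_mset_cong [of xs ys]) (auto intro!: arg_cong [of _ _ sum_list] sum_list_mset_cong)

lemma min_sum_Cons: "min_sum (w # ws) = min_sum ws + w + 2 * (\<Sum>x\<leftarrow>ws. min w x)"
proof -
  have "(\<Sum>x\<leftarrow>ws. min x w) = (\<Sum>x\<leftarrow>ws. min w x)"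
    by (simp add: min.commute)
  then show ?thesis
    by (simp add: min_sum_def sum_list_addf)
qed

lemma min_sum_of_int: "real_of_int (min_sum ws) = min_sum (map real_of_int ws)"
proof -
  have *: "real_of_int (\<Sum>y\<leftarrow>us. f y) = (\<Sum>y\<leftarrow>us. real_of_int (f y))" for us and f :: "int \<Rightarrow> int"
    by (induction us) auto
  show ?thesis
    by (simp add: min_sum_def * o_def of_int_min)
qed

lemma sum_list_pairs: "(\<Sum>x\<leftarrow>xs. \<Sum>y\<leftarrow>xs. f x * f y) = (\<Sum>x\<leftarrow>xs. f x :: real)\<^sup>2"
  by (simp add: sum_list_mult_const sum_list_const_mult power2_eq_square)

text \<open>
  With \<open>t x = min w x - m\<close>, \<open>d = w - m\<close> and \<open>T = sum t\<close>, the estimate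
  \<open>min a b \<ge> a * b / d\<close> on \<open>[0, d]\<close> reduces the claim to \<open>(k * d - 2 * T)\<^sup>2 \<ge> 0\<close>.
\<close>
lemma vertex_dual_exchange:
  fixes w m :: real
  assumes k: "0 < k" and m: "0 \<le> m" "m \<le> w" "\<And>x. x \<in> set old \<Longrightarrow> m \<le> x"
    and full: "length old = k \<or> m = 0"
    and new: "mset new = mset (w # old) \<and> m = 0 \<or> mset (m # new) = mset (w # old)"
  shows "(w - vertex_dual k old) + real k * (vertex_dual k new - vertex_dual k old)
      \<le> (13/8 + 1 / (2 * real k)) * (sum_list new - sum_list old)"
    and "vertex_dual k old \<le> vertex_dual k new" and "sum_list old \<le> sum_list new"
proof -
  \<comment> \<open>\<open>m\<close> is the price that is given up, possibly \<open>w\<close>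
    itself, and 0 if there is room. In all cases \<open>d\<close> is the increase of the sum of
    prices.\<close>
  define d where "d = w - m"
  define t where "t x = min w x - m" for x
  define T where "T = (\<Sum>x\<leftarrow>old. t x)"
  define q where "q = (\<Sum>x\<leftarrow>old. \<Sum>y\<leftarrow>old. min (t x) (t y))"
  define n where "n = real (length old)"
  have nm: "n * m = k * m"
    using full by (auto simp: n_def)
  have d: "0 \<le> d"
    using m by (simp add: d_def)
  have t: "0 \<le> t x" "t x \<le> d" "m + t x \<le> x" if "x \<in> set old" for x
    using m that by (auto simp: t_def d_def)
  have T0: "0 \<le> T"
    unfolding T_def using t by (intro sum_list_nonneg) auto
  have Tm: "(\<Sum>x\<leftarrow>old. min w x) = T + n * m"
    by (simp add: T_def t_def n_def sum_list_subtractf sum_list_triv)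
  have S_new: "sum_list new = sum_list old + d"
  proof -
    have "sum_list (map id new) + m = sum_list (map id (w # old))"
      using new
    proof
      assume "mset new = mset (w # old) \<and> m = 0"
      then show ?thesis
        using sum_list_mset_cong [of new "w # old" id] by simp
    next
      assume "mset (m # new) = mset (w # old)"
      from sum_list_mset_cong [OF this, of id] show ?thesis
        by simp
    qed
    then show ?thesis
      by (simp add: d_def)
  qed
  then show "sum_list old \<le> sum_list new"
    using d by simp
  \<comment> \<open>In an eviction \<open>m\<close> is a minimum, so every pair that contains it
    contributes exactly \<open>m\<close>.\<close>
  have Q_new: "min_sum new = min_sum old + d + 2 * T"
    using new
  proof
    assume a: "mset new = mset (w # old) \<and> m = 0"
    then have "min_sum new = min_sum (w # old)"
      by (intro min_sum_mset_cong) simp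
    then show ?thesis
      using a Tm by (simp add: min_sum_Cons d_def)
  next
    assume a: "mset (m # new) = mset (w # old)"
    then have "m \<le> x" if "x \<in> set new" for x
      using that m(2,3) by (metis set_ConsD set_mset_mset list.set_intros(2))
    then have "(\<Sum>x\<leftarrow>new. min m x) = (\<Sum>x\<leftarrow>new. m)"
      by (intro arg_cong [of _ _ sum_list]) auto
    moreover have "length new = length old"
      using a by (metis size_mset length_Cons nat.inject)
    ultimately show ?thesis
      using min_sum_mset_cong [OF a] Tm by (simp add: min_sum_Cons d_def sum_list_triv n_def)
  qed
  have S_old: "k * m + T \<le> sum_list old"
  proof -
    have "(\<Sum>x\<leftarrow>old. m + t x) \<le> (\<Sum>x\<leftarrow>old. x)"
      using t by (intro sum_list_mono) auto
    then show ?thesis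
      using full by (auto simp: T_def sum_list_addf sum_list_triv)
  qed
  have Q_old: "k * (k * m) + q \<le> min_sum old"
  proof -
    have "(\<Sum>x\<leftarrow>old. \<Sum>y\<leftarrow>old. m + min (t x) (t y)) \<le> min_sum old"
      unfolding min_sum_def using t by (intro sum_list_mono) (auto simp: min_def; smt (verit))
    moreover have "(\<Sum>x\<leftarrow>old. \<Sum>y\<leftarrow>old. m + min (t x) (t y)) = n * (n * m) + q"
      by (simp add: q_def n_def sum_list_addf sum_list_triv)
    moreover have "n * (n * m) = k * (k * m)"
      using full by (auto simp: n_def)
    ultimately show ?thesis
      by simp
  qed
  have "T\<^sup>2 \<le> d * q"
  proof -
    have "(\<Sum>x\<leftarrow>old. \<Sum>y\<leftarrow>old. t x * t y) \<le> (\<Sum>x\<leftarrow>old. \<Sum>y\<leftarrow>old. d * min (t x) (t y))"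
    proof (intro sum_list_mono)
      fix x y assume "x \<in> set old" "y \<in> set old"
      then show "t x * t y \<le> d * min (t x) (t y)"
        using t [of x] t [of y] mult_left_mono [of "t y" d "t x"] mult_right_mono [of "t x" d "t y"]
        by (cases "t x \<le> t y") (auto simp: min_def mult.commute [of d])
    qed
    then show ?thesis
      using sum_list_pairs [of t old] by (simp add: T_def q_def sum_list_const_mult)
  qed
  have q: "k * T - q \<le> k * (k * d) / 4"
  proof (cases "d = 0")
    case True
    then have "T = 0"
      using \<open>T\<^sup>2 \<le> d * q\<close> by simp
    moreover have "0 \<le> q"
      unfolding q_def using t by (intro sum_list_nonneg) (auto intro!: sum_list_nonneg)
    ultimately show ?thesis
      using True by simp
  next
    case False
    have "0 \<le> (k * d - 2 * T)\<^sup>2"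
      by simp
    then have "d * (4 * (k * T - q)) \<le> d * (k * (k * d))"
      using \<open>T\<^sup>2 \<le> d * q\<close> by (simp add: power2_eq_square algebra_simps)
    then show ?thesis
      using False d by (simp add: mult_le_cancel_left_pos)
  qed
  \<comment> \<open>Multiplied by \<open>2 k\<^sup>2\<close>, the left-hand side is at most
    \<open>2 k\<^sup>2 (w - m) + k\<^sup>2 d + k d + (k T - q)\<close> by \<open>S_old\<close> and
    \<open>Q_old\<close>. The constant is \<open>13/4 = 2 + 1 + 1/4\<close>.\<close>
  define K where "K = real k"
  have "K * (K * m + T) \<le> K * sum_list old"
    using S_old by (intro mult_left_mono) (auto simp: K_def)
  moreover have "K * (K * d) = K * (K * w) - K * (K * m)"
    by (simp add: d_def right_diff_distrib)
  moreover have "(13/4 * (K * K) + K) * d = 13/4 * (K * (K * d)) + K * d"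
    by (simp add: distrib_right)
  moreover have "K * (K * d + d + 2 * T) = K * (K * d) + K * d + 2 * (K * T)"
    by (simp add: distrib_left)
  moreover have "K * (K * m + T) = K * (K * m) + K * T"
    by (simp add: distrib_left)
  ultimately have num: "2 * (K * (K * w)) - K * sum_list old - min_sum old + K * (K * d + d + 2 * T)
      \<le> (13/4 * (K * K) + K) * d"
    using Q_old q unfolding K_def [symmetric] by argo
  have diff: "vertex_dual k new - vertex_dual k old = (K * d + d + 2 * T) / (2 * K\<^sup>2)"
    by (simp add: vertex_dual_def S_new Q_new K_def diff_divide_distrib [symmetric] algebra_simps)
  moreover have "0 \<le> (K * d + d + 2 * T) / (2 * K\<^sup>2)"
    using d T0 by (simp add: K_def)
  ultimately show "vertex_dual k old \<le> vertex_dual k new"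
    by linarith
  have "K \<noteq> 0"
    using k by (simp add: K_def)
  then have "w - vertex_dual k old + K * (vertex_dual k new - vertex_dual k old)
      = (2 * (K * (K * w)) - K * sum_list old - min_sum old + K * (K * d + d + 2 * T)) / (2 * K\<^sup>2)"
    unfolding diff by (simp add: vertex_dual_def K_def power2_eq_square field_simps)
  also have "\<dots> \<le> ((13/4 * (K * K) + K) * d) / (2 * K\<^sup>2)"
    using num by (intro divide_right_mono) auto
  also have "\<dots> = (13/8 + 1 / (2 * K)) * d"
    using \<open>K \<noteq> 0\<close> by (simp add: power2_eq_square field_simps)
  finally show "w - vertex_dual k old + real k * (vertex_dual k new - vertex_dual k old)
      \<le> (13/8 + 1 / (2 * real k)) * (sum_list new - sum_list old)"
    by (simp add: S_new K_def)
qed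

text \<open>\<open>\<theta>\<close> is the first value left out, \<open>f (l ! c)\<close> with
  indices from 0, or 0 if nothing is left out. The taken values exceed it by their sum minus
  \<open>c * \<theta>\<close> in total, and the others do not exceed it. It is the dual multiplier
  of the constraint that at most \<open>c\<close> items be taken.\<close>

lemma top_sum_threshold:
  fixes f :: "'a \<Rightarrow> real"
  assumes "sorted (map g l)" "\<And>x y. x \<in> set l \<Longrightarrow> y \<in> set l \<Longrightarrow> g x \<le> g y \<Longrightarrow> f y \<le> f x"
    and "\<And>x. x \<in> set l \<Longrightarrow> 0 \<le> f x"
  shows "\<exists>\<theta>\<ge>0. c * \<theta> + (\<Sum>x\<leftarrow>l. max 0 (f x - \<theta>)) \<le> (\<Sum>x\<leftarrow>take c l. f x)"
proof (cases "length l \<le> c")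
  case True
  then have "(\<Sum>x\<leftarrow>l. max 0 (f x - 0)) = (\<Sum>x\<leftarrow>take c l. f x)"
    using assms(3) by (auto intro!: arg_cong [of _ _ sum_list])
  then show ?thesis
    by (intro exI [of _ 0]) simp
next
  case False
  define \<theta> where "\<theta> = f (l ! c)"
  have c: "c < length l"
    using False by simp
  have le: "f (l ! j) \<le> f (l ! i)" if "i \<le> j" "j < length l" for i j
    using that assms(1,2) by (auto simp: sorted_iff_nth_mono)
  have "(\<Sum>x\<leftarrow>take c l. max 0 (f x - \<theta>)) = (\<Sum>x\<leftarrow>take c l. f x - \<theta>)"
    using c le by (intro arg_cong [of _ _ sum_list] map_cong) (auto simp: in_set_conv_nth \<theta>_def)
  moreover have "(\<Sum>x\<leftarrow>drop c l. max 0 (f x - \<theta>)) = (\<Sum>x\<leftarrow>drop c l. 0)"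
    using c le by (intro arg_cong [of _ _ sum_list] map_cong) (auto simp: in_set_conv_nth \<theta>_def)
  moreover have "(\<Sum>x\<leftarrow>l. max 0 (f x - \<theta>))
      = (\<Sum>x\<leftarrow>take c l. max 0 (f x - \<theta>)) + (\<Sum>x\<leftarrow>drop c l. max 0 (f x - \<theta>))"
    by (metis append_take_drop_id map_append sum_list_append)
  ultimately have "(\<Sum>x\<leftarrow>l. max 0 (f x - \<theta>)) = (\<Sum>x\<leftarrow>take c l. f x) - c * \<theta>"
    using c by (simp add: sum_list_subtractf sum_list_triv)
  then show ?thesis
    using assms(3) c by (intro exI [of _ \<theta>]) (simp add: \<theta>_def)
qed

section \<open>Weak duality\<close>

lemma incident_lside:
  assumes "wf_instance I" "u \<in> lside I"
  shows "incident I u = {e \<in> edges I. lend I e = u}"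
  using assms by (auto simp: wf_instance_def incident_def)

lemma incident_rside:
  assumes "wf_instance I" "v \<in> rside I"
  shows "incident I v = {e \<in> edges I. rend I e = v}"
  using assms by (auto simp: wf_instance_def incident_def)

text \<open>
  An infinite capacity may be replaced by any number that is at least the number of edges.
  A dual solution is given by \<open>\<alpha>\<close> and \<open>\<beta>\<close>, the value \<open>\<theta>\<close> being the multiplier
  of the capacity constraint of \<open>u\<close> for the price \<open>p\<close>.
\<close>
lemma lp_value_le_dual:
  fixes I :: "('v, 'e) pricing_instance" and k :: "'v \<Rightarrow> nat" and \<alpha> \<beta> :: "'v \<Rightarrow> real"
  assumes wf: "wf_instance I" and lp: "lp_feasible I y x"
    and k: "\<And>w. w \<in> lside I \<union> rside I \<Longrightarrow>
      cap I w = enat (k w) \<or> cap I w = \<infinity> \<and> card (edges I) \<le> k w"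
    and beta: "\<And>v. v \<in> rside I \<Longrightarrow> 0 \<le> \<beta> v"
    and alpha: "\<And>u p. u \<in> lside I \<Longrightarrow> p \<in> prices I u \<Longrightarrow>
      \<exists>\<theta>\<ge>0. real (k u) * \<theta> + (\<Sum>e | e \<in> incident I u \<and> p \<in> edge_prices I e. max 0 (p - \<beta> (rend I e) - \<theta>)) \<le> \<alpha> u"
  shows "lp_value I x \<le> (\<Sum>u\<in>lside I. \<alpha> u) + (\<Sum>v\<in>rside I. real (k v) * \<beta> v)"
proof -
  have fin: "finite (lside I)" "finite (rside I)" "finite (edges I)"
    and ends: "\<And>e. e \<in> edges I \<Longrightarrow> lend I e \<in> lside I" "\<And>e. e \<in> edges I \<Longrightarrow> rend I e \<in> rside I"
    using wf by (auto simp: wf_instance_def)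
  have fin_inc: "finite (incident I w)" and inc: "incident I w \<subseteq> edges I" for w
    using fin by (auto simp: incident_def)
  have fin_prices: "finite (prices I w)" for w
    unfolding prices_def using fin_inc by blast
  have fin_ep: "finite (edge_prices I e)" for e
    unfolding edge_prices_def using fin_prices by simp
  have y0: "0 \<le> y u p" if "u \<in> lside I" "p \<in> prices I u" for u p
    using lp that by (auto simp: lp_feasible_def)
  have x0: "0 \<le> x e p" if "e \<in> edges I" "p \<in> edge_prices I e" for e p
    using lp that by (auto simp: lp_feasible_def)
  have y1: "(\<Sum>p\<in>prices I u. y u p) = 1" if "u \<in> lside I" for u
    using lp that by (auto simp: lp_feasible_def)
  have xy: "x e p \<le> y (lend I e) p" if "e \<in> edges I" "p \<in> edge_prices I e" for e p
    using lp that ends by (auto simp: lp_feasible_def incident_def)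
  \<comment> \<open>An edge carries total weight at most 1. For an infinite capacity on the right
    this yields the bound by the number of edges, in place of a constraint.\<close>
  have x_sum_le_1: "(\<Sum>p\<in>edge_prices I e. x e p) \<le> 1" if e: "e \<in> edges I" for e
  proof -
    have "(\<Sum>p\<in>edge_prices I e. x e p) \<le> (\<Sum>p\<in>edge_prices I e. y (lend I e) p)"
      using xy e by (intro sum_mono)
    also have "\<dots> \<le> (\<Sum>p\<in>prices I (lend I e). y (lend I e) p)"
      using fin_prices y0 ends(1) [OF e] by (intro sum_mono2) (auto simp: edge_prices_def)
    finally show ?thesis
      using y1 ends(1) [OF e] by simp
  qed
  have right: "(\<Sum>e\<in>incident I v. \<Sum>p\<in>edge_prices I e. x e p) \<le> k v" if v: "v \<in> rside I" for v
  proof (cases "cap I v = \<infinity>")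
    case True
    then have "card (edges I) \<le> k v"
      using k [of v] v by auto
    have "(\<Sum>e\<in>incident I v. \<Sum>p\<in>edge_prices I e. x e p) \<le> card (incident I v)"
      using sum_mono [of "incident I v" "\<lambda>e. \<Sum>p\<in>edge_prices I e. x e p" "\<lambda>_. 1"] x_sum_le_1 inc
      by auto
    also have "\<dots> \<le> card (edges I)"
      using inc fin(3) by (simp add: card_mono)
    finally show ?thesis
      using \<open>card (edges I) \<le> k v\<close> by simp
  next
    case False
    then have "cap I v = enat (k v)"
      using k [of v] v by auto
    then show ?thesis
      using lp v by (auto simp: lp_feasible_def)
  qed
  have left: "(\<Sum>e | e \<in> incident I u \<and> p \<in> edge_prices I e. x e p) \<le> real (k u) * y u p"
    if u: "u \<in> lside I" and p: "p \<in> prices I u" for u p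
  proof (cases "cap I u = \<infinity>")
    case True
    then have "card (edges I) \<le> k u"
      using k [of u] u by auto
    moreover have "card {e. e \<in> incident I u \<and> p \<in> edge_prices I e} \<le> card (edges I)"
      using inc fin(3) by (intro card_mono) auto
    ultimately have card: "real (card {e. e \<in> incident I u \<and> p \<in> edge_prices I e}) \<le> k u"
      by simp
    have "(\<Sum>e | e \<in> incident I u \<and> p \<in> edge_prices I e. x e p)
        \<le> (\<Sum>e | e \<in> incident I u \<and> p \<in> edge_prices I e. y u p)"
      using xy u by (intro sum_mono) (auto simp: incident_lside [OF wf])
    also have "\<dots> \<le> real (k u) * y u p"
      using card y0 [OF u p] by (simp add: mult_right_mono)
    finally show ?thesis .
  next
    case False
    then have "cap I u = enat (k u)"
      using k [of u] u by auto
    then show ?thesis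
      using lp u p by (auto simp: lp_feasible_def)
  qed
  have local_bound: "(\<Sum>e | e \<in> incident I u \<and> p \<in> edge_prices I e. (p - \<beta> (rend I e)) * x e p) \<le> \<alpha> u * y u p"
    if u: "u \<in> lside I" and p: "p \<in> prices I u" for u p
  proof -
    let ?E = "{e. e \<in> incident I u \<and> p \<in> edge_prices I e}"
    obtain \<theta> where \<theta>: "0 \<le> \<theta>" "real (k u) * \<theta> + (\<Sum>e\<in>?E. max 0 (p - \<beta> (rend I e) - \<theta>)) \<le> \<alpha> u"
      using alpha [OF u p] by (elim exE conjE)
    have "(\<Sum>e\<in>?E. (p - \<beta> (rend I e)) * x e p)
        = (\<Sum>e\<in>?E. (p - \<beta> (rend I e) - \<theta>) * x e p + \<theta> * x e p)"
      by (intro sum.cong) (auto simp: algebra_simps)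
    also have "\<dots> = (\<Sum>e\<in>?E. (p - \<beta> (rend I e) - \<theta>) * x e p) + \<theta> * (\<Sum>e\<in>?E. x e p)"
      by (simp add: sum.distrib sum_distrib_left)
    \<comment> \<open>The maximum with 0 is the optimal multiplier of the constraint
      \<open>x e p \<le> y u p\<close> for given \<open>\<beta>\<close> and
      \<open>\<theta>\<close>.\<close>
    also have "\<dots> \<le> (\<Sum>e\<in>?E. max 0 (p - \<beta> (rend I e) - \<theta>) * y u p) + \<theta> * (real (k u) * y u p)"
    proof (intro add_mono mult_left_mono sum_mono left u p \<theta>(1))
      fix e assume e: "e \<in> ?E"
      then have "0 \<le> x e p" "x e p \<le> y u p"
        using x0 [of e p] xy [of e p] u by (auto simp: incident_lside [OF wf])
      then show "(p - \<beta> (rend I e) - \<theta>) * x e p \<le> max 0 (p - \<beta> (rend I e) - \<theta>) * y u p"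
        by (intro mult_mono) auto
    qed
    also have "\<dots> = (real (k u) * \<theta> + (\<Sum>e\<in>?E. max 0 (p - \<beta> (rend I e) - \<theta>))) * y u p"
      by (simp add: distrib_right sum_distrib_right)
    also have "\<dots> \<le> \<alpha> u * y u p"
      using \<theta>(2) y0 [OF u p] by (rule mult_right_mono)
    finally show ?thesis .
  qed
  have "(\<Sum>e\<in>edges I. \<Sum>p\<in>edge_prices I e. (p - \<beta> (rend I e)) * x e p)
      = (\<Sum>u\<in>lside I. \<Sum>e\<in>incident I u. \<Sum>p\<in>edge_prices I e. (p - \<beta> (rend I e)) * x e p)"
    using ends by (subst sum.group [OF fin(3,1), of "lend I", symmetric])
      (auto simp: incident_lside [OF wf] intro!: sum.cong)
  also have "\<dots> = (\<Sum>u\<in>lside I. \<Sum>p\<in>prices I u.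
      \<Sum>e | e \<in> incident I u \<and> p \<in> edge_prices I e. (p - \<beta> (rend I e)) * x e p)"
  proof (intro sum.cong refl)
    fix u assume u: "u \<in> lside I"
    have "edge_prices I e = {p \<in> prices I u. p \<in> edge_prices I e}" if "e \<in> incident I u" for e
      using that u by (auto simp: edge_prices_def incident_lside [OF wf])
    then have "(\<Sum>e\<in>incident I u. \<Sum>p\<in>edge_prices I e. (p - \<beta> (rend I e)) * x e p)
        = (\<Sum>e\<in>incident I u. \<Sum>p | p \<in> prices I u \<and> p \<in> edge_prices I e. (p - \<beta> (rend I e)) * x e p)"
      by (intro sum.cong) auto
    also have "\<dots> = (\<Sum>p\<in>prices I u.
        \<Sum>e | e \<in> incident I u \<and> p \<in> edge_prices I e. (p - \<beta> (rend I e)) * x e p)"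
      by (rule sum.swap_restrict [OF fin_inc fin_prices])
    finally show "(\<Sum>e\<in>incident I u. \<Sum>p\<in>edge_prices I e. (p - \<beta> (rend I e)) * x e p) = \<dots>" .
  qed
  also have "\<dots> \<le> (\<Sum>u\<in>lside I. \<Sum>p\<in>prices I u. \<alpha> u * y u p)"
    by (intro sum_mono local_bound)
  also have "\<dots> = (\<Sum>u\<in>lside I. \<alpha> u)"
    by (intro sum.cong) (auto simp: sum_distrib_left [symmetric] y1)
  finally have A: "(\<Sum>e\<in>edges I. \<Sum>p\<in>edge_prices I e. (p - \<beta> (rend I e)) * x e p) \<le> (\<Sum>u\<in>lside I. \<alpha> u)" .
  have "(\<Sum>e\<in>edges I. \<Sum>p\<in>edge_prices I e. \<beta> (rend I e) * x e p)
      = (\<Sum>v\<in>rside I. \<Sum>e\<in>incident I v. \<Sum>p\<in>edge_prices I e. \<beta> (rend I e) * x e p)"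
    using ends by (subst sum.group [OF fin(3,2), of "rend I", symmetric])
      (auto simp: incident_rside [OF wf] intro!: sum.cong)
  also have "\<dots> = (\<Sum>v\<in>rside I. \<beta> v * (\<Sum>e\<in>incident I v. \<Sum>p\<in>edge_prices I e. x e p))"
    by (intro sum.cong) (auto simp: sum_distrib_left incident_rside [OF wf] intro!: sum.cong)
  also have "\<dots> \<le> (\<Sum>v\<in>rside I. \<beta> v * k v)"
    by (intro sum_mono mult_left_mono right beta)
  finally have B: "(\<Sum>e\<in>edges I. \<Sum>p\<in>edge_prices I e. \<beta> (rend I e) * x e p) \<le> (\<Sum>v\<in>rside I. real (k v) * \<beta> v)"
    by (simp add: mult.commute)
  have "lp_value I x = (\<Sum>e\<in>edges I. \<Sum>p\<in>edge_prices I e. (p - \<beta> (rend I e)) * x e p + \<beta> (rend I e) * x e p)"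
    unfolding lp_value_def by (intro sum.cong) (auto simp: algebra_simps)
  also have "\<dots> = (\<Sum>e\<in>edges I. \<Sum>p\<in>edge_prices I e. (p - \<beta> (rend I e)) * x e p)
      + (\<Sum>e\<in>edges I. \<Sum>p\<in>edge_prices I e. \<beta> (rend I e) * x e p)"
    by (simp add: sum.distrib)
  finally show ?thesis
    using A B by linarith
qed

section \<open>The greedy algorithm\<close>

text \<open>
  An edge is given by its name, its left end, its right end, its budget, scaled to an integer,
  and the capacity of its right end. An item is an edge together with the price at which it is
  sold.
\<close>
type_synonym edge_rec = "int \<times> int \<times> int \<times> int \<times> int"
type_synonym item = "int \<times> edge_rec"

abbreviation e_id :: "edge_rec \<Rightarrow> int" where "e_id e \<equiv> fst e"
abbreviation e_left :: "edge_rec \<Rightarrow> int" where "e_left e \<equiv> fst (snd e)"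
abbreviation e_right :: "edge_rec \<Rightarrow> int" where "e_right e \<equiv> fst (snd (snd e))"
abbreviation e_weight :: "edge_rec \<Rightarrow> int" where "e_weight e \<equiv> fst (snd (snd (snd e)))"
abbreviation e_cap :: "edge_rec \<Rightarrow> int" where "e_cap e \<equiv> snd (snd (snd (snd e)))"

definition kept_weights :: "item list \<Rightarrow> int \<Rightarrow> int list" where
  "kept_weights K v = map fst (filter (\<lambda>i. e_right (snd i) = v) K)"

text \<open>The integer \<open>M\<close> clears the denominators of all the vertex duals.\<close>
definition scaled_dual :: "int \<Rightarrow> item list \<Rightarrow> edge_rec \<Rightarrow> int" where
  "scaled_dual M K e =
     (e_cap e * sum_list (kept_weights K (e_right e)) + min_sum (kept_weights K (e_right e)))
       * (M div (2 * e_cap e * e_cap e))"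

text \<open>For a fixed price an edge gains the more the smaller the dual of its right end. After
  sorting by the dual and discarding the edges without gain, a prefix is a best set of bounded
  size.\<close>

definition candidates :: "int \<Rightarrow> item list \<Rightarrow> edge_rec list \<Rightarrow> int \<Rightarrow> edge_rec list" where
  "candidates M K es w =
     sort_key (scaled_dual M K) (filter (\<lambda>e. w \<le> e_weight e \<and> scaled_dual M K e < M * w) es)"

definition chosen :: "int \<Rightarrow> item list \<Rightarrow> edge_rec list \<Rightarrow> int \<Rightarrow> int \<Rightarrow> edge_rec list" where
  "chosen M K es c w = take (nat c) (candidates M K es w)"

definition gain :: "int \<Rightarrow> item list \<Rightarrow> edge_rec list \<Rightarrow> int \<Rightarrow> int \<Rightarrow> int" where
  "gain M K es c w = (\<Sum>e\<leftarrow>chosen M K es c w. M * w - scaled_dual M K e)"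

text \<open>The price 0 keeps the list nonempty even if the vertex has no edge. Negating the key
  puts a maximizer in front.\<close>

definition best_price :: "int \<Rightarrow> item list \<Rightarrow> edge_rec list \<Rightarrow> int \<Rightarrow> int" where
  "best_price M K es c = hd (sort_key (\<lambda>w. - gain M K es c w) (0 # map e_weight es))"

definition offers :: "int \<Rightarrow> item list \<Rightarrow> edge_rec list \<Rightarrow> int \<Rightarrow> item list" where
  "offers M K es c = map (Pair (best_price M K es c)) (chosen M K es c (best_price M K es c))"

text \<open>Sorting by decreasing price makes the truncation drop the cheapest item, which may be
  the new one.\<close>

definition insert_item :: "item list \<Rightarrow> item \<Rightarrow> item list" where
  "insert_item K i = filter (\<lambda>j. e_right (snd j) \<noteq> e_right (snd i)) K
     @ take (nat (e_cap (snd i)))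
         (sort_key (\<lambda>j. - fst j) (i # filter (\<lambda>j. e_right (snd j) = e_right (snd i)) K))"

definition greedy_step ::
    "int \<Rightarrow> edge_rec list \<Rightarrow> item list \<times> (int \<times> int) list \<Rightarrow> int \<times> int \<Rightarrow> item list \<times> (int \<times> int) list" where
  "greedy_step M E s u =
     (let es = filter (\<lambda>e. e_left e = fst u) E
      in (foldl insert_item (fst s) (offers M (fst s) es (snd u)),
          (fst u, best_price M (fst s) es (snd u)) # snd s))"

definition greedy :: "int \<Rightarrow> edge_rec list \<Rightarrow> (int \<times> int) list \<Rightarrow> item list \<times> (int \<times> int) list" where
  "greedy M E us = foldl (greedy_step M E) ([], []) us"

lemma best_price:
  shows "best_price M K es c \<in> insert 0 (e_weight ` set es)"
    and "w \<in> e_weight ` set es \<Longrightarrow> gain M K es c w \<le> gain M K es c (best_price M K es c)"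
proof -
  define l where "l = sort_key (\<lambda>w. - gain M K es c w) (0 # map e_weight es)"
  have l: "set l = insert 0 (e_weight ` set es)" "sorted (map (\<lambda>w. - gain M K es c w) l)"
    by (auto simp: l_def set_insort_key sorted_insort_key simp del: sort_key_simps(2))
  then obtain z zs where z: "l = z # zs"
    by (cases l) auto
  then have best: "best_price M K es c = z"
    unfolding best_price_def l_def [symmetric] by simp
  show "best_price M K es c \<in> insert 0 (e_weight ` set es)"
    unfolding best l(1) [symmetric] by (simp add: z)
  show "gain M K es c w \<le> gain M K es c (best_price M K es c)" if "w \<in> e_weight ` set es"
  proof -
    have "w \<in> set l"
      using l(1) that by simp
    then show ?thesis
      unfolding best using l(2) by (auto simp: z)
  qed
qed

lemma distinct_mset_mono: "mset xs \<subseteq># mset ys \<Longrightarrow> distinct ys \<Longrightarrow> distinct xs"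
  unfolding distinct_count_atmost_1
  by (metis count_eq_zero_iff le_less_Suc_eq le_zero_eq mset_subset_eq_count not_one_le_zero
      One_nat_def less_one linorder_not_less nat_less_le set_mset_mset)

abbreviation greedy_ratio :: real where "greedy_ratio \<equiv> 13/8 + 1/44"

section \<open>Amortized analysis of the greedy algorithm\<close>

locale greedy_pricing =
  fixes M :: int and E :: "edge_rec list" and kap :: "int \<Rightarrow> nat"
  assumes distinct_E: "distinct E"
    and simple: "inj_on (\<lambda>e. (e_left e, e_right e)) (set E)"
    and cap_E: "\<And>e. e \<in> set E \<Longrightarrow> e_cap e = int (kap (e_right e))"
    and kap_ge: "\<And>e. e \<in> set E \<Longrightarrow> 22 \<le> kap (e_right e)"
    and M_pos: "0 < M"
    and M_dvd: "\<And>e. e \<in> set E \<Longrightarrow> 2 * e_cap e * e_cap e dvd M"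
    and weight_nonneg: "\<And>e. e \<in> set E \<Longrightarrow> 0 \<le> e_weight e"
begin

definition dual :: "item list \<Rightarrow> int \<Rightarrow> real" where
  "dual K v = vertex_dual (kap v) (map real_of_int (kept_weights K v))"

definition proceeds :: "item list \<Rightarrow> real" where
  "proceeds K = (\<Sum>i\<leftarrow>K. real_of_int (fst i))"

text \<open>The right-hand part of the dual objective. Right vertices without edges are left out, as
  nothing is kept there and their dual is 0.\<close>

definition potential :: "item list \<Rightarrow> real" where
  "potential K = (\<Sum>v\<in>e_right ` set E. real (kap v) * dual K v)"

definition valid :: "item list \<Rightarrow> bool" where
  "valid K \<longleftrightarrow> (\<forall>i\<in>set K. snd i \<in> set E \<and> 0 \<le> fst i) \<and>
     (\<forall>v\<in>e_right ` set E. length (filter (\<lambda>i. e_right (snd i) = v) K) \<le> kap v)"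

lemma scaled_dual_eq:
  assumes e: "e \<in> set E"
  shows "real_of_int (scaled_dual M K e) = real_of_int M * dual K (e_right e)"
proof -
  define c where "c = real (kap (e_right e))"
  have c: "real_of_int (e_cap e) = c" "c \<noteq> 0"
    using cap_E [OF e] kap_ge [OF e] by (auto simp: c_def)
  have of_int_sum: "real_of_int (sum_list ws) = sum_list (map real_of_int ws)" for ws
    by (induction ws) auto
  have "real_of_int (M div (2 * e_cap e * e_cap e)) = M / (2 * c\<^sup>2)"
    using M_dvd [OF e] c by (simp add: real_of_int_div power2_eq_square)
  then show ?thesis
    using c by (simp add: scaled_dual_def dual_def vertex_dual_def c_def min_sum_of_int of_int_sum)
qed

lemma insert_item:
  assumes K: "valid K" and e: "e \<in> set E" and w: "0 \<le> w"
  shows "valid (insert_item K (w, e))"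
    and "mset (insert_item K (w, e)) \<subseteq># add_mset (w, e) (mset K)"
    and "v \<noteq> e_right e \<Longrightarrow> dual (insert_item K (w, e)) v = dual K v"
    and "dual K v \<le> dual (insert_item K (w, e)) v"
    and "real_of_int w - dual K (e_right e) + (potential (insert_item K (w, e)) - potential K)
      \<le> greedy_ratio * (proceeds (insert_item K (w, e)) - proceeds K)"
proof -
  define K' where "K' = insert_item K (w, e)"
  define a where "a = e_right e"
  define old where "old = filter (\<lambda>j. e_right (snd j) = a) K"
  define rest where "rest = filter (\<lambda>j. e_right (snd j) \<noteq> a) K"
  define L where "L = sort_key (\<lambda>j. - fst j) ((w, e) # old)"
  define new where "new = take (kap a) L"
  have K': "K' = rest @ new"
    using cap_E [OF e] by (simp add: K'_def insert_item_def rest_def new_def L_def old_def a_def)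
  have mset_L: "mset L = add_mset (w, e) (mset old)"
    by (simp add: L_def)
  then have set_L: "set L = insert (w, e) (set old)"
    by (metis set_mset_mset set_mset_add_mset_insert)
  have mset_K: "mset K = mset rest + mset old"
    using multiset_partition [of "mset K" "\<lambda>j. e_right (snd j) \<noteq> a"] by (simp add: rest_def old_def)
  have L_a: "\<forall>j\<in>set L. e_right (snd j) = a"
    by (auto simp: set_L old_def a_def)
  have set_new: "set new \<subseteq> set L"
    by (simp add: new_def set_take_subset)
  have filter_new: "filter (\<lambda>j. e_right (snd j) = a) K' = new"
    using L_a set_new by (auto simp: K' rest_def filter_empty_conv filter_id_conv)
  have filter_other: "filter (\<lambda>j. e_right (snd j) = v) K' = filter (\<lambda>j. e_right (snd j) = v) K" if "v \<noteq> a" for v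
  proof -
    have "filter (\<lambda>j. e_right (snd j) = v) new = []"
      using L_a set_new that by (auto simp: filter_empty_conv)
    moreover have "filter (\<lambda>j. e_right (snd j) = v) rest = filter (\<lambda>j. e_right (snd j) = v) K"
      unfolding rest_def filter_filter using that by (intro filter_cong) auto
    ultimately show ?thesis
      by (simp add: K')
  qed
  have kap_a: "22 \<le> kap a"
    using kap_ge [OF e] by (simp add: a_def)
  have nonneg: "0 \<le> fst j" if "j \<in> set L" for j
    using that K w by (auto simp: set_L old_def valid_def)
  have len_old: "length old \<le> kap a"
    using K e by (auto simp: valid_def old_def a_def)
  have len_L: "length L = Suc (length old)"
    using mset_L by (metis size_mset size_add_mset)
  have sub_L: "mset new \<subseteq># mset L"
    unfolding new_def by (metis append_take_drop_id mset_append mset_subset_eq_add_left)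
  show sub: "mset (insert_item K (w, e)) \<subseteq># add_mset (w, e) (mset K)"
    using sub_L unfolding K'_def [symmetric] K' mset_K mset_L by simp
  show "valid (insert_item K (w, e))"
    unfolding K'_def [symmetric] valid_def
  proof (intro conjI ballI)
    show "snd i \<in> set E" "0 \<le> fst i" if "i \<in> set K'" for i
      using mset_subset_eqD [OF sub, folded K'_def, of i] that K e w by (auto simp: valid_def)
    show "length (filter (\<lambda>i. e_right (snd i) = v) K') \<le> kap v" if "v \<in> e_right ` set E" for v
      using K that filter_new filter_other by (cases "v = a") (auto simp: valid_def new_def)
  qed
  show other: "dual (insert_item K (w, e)) v = dual K v" if "v \<noteq> e_right e" for v
    using filter_other [of v] that by (simp add: K'_def dual_def kept_weights_def a_def)
  define oldw where "oldw = map (real_of_int \<circ> fst) old"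
  define neww where "neww = map (real_of_int \<circ> fst) new"
  have dual_a: "dual K a = vertex_dual (kap a) oldw" "dual K' a = vertex_dual (kap a) neww"
    by (simp_all add: dual_def kept_weights_def oldw_def neww_def filter_new old_def)
  have mset_Lw: "image_mset (real_of_int \<circ> fst) (mset L) = mset (real_of_int w # oldw)"
    by (simp add: mset_L oldw_def)
  \<comment> \<open>If the vertex was full, \<open>L\<close> has one item too many, and
    \<open>m\<close> is the price of its last, hence cheapest, item. Otherwise nothing is dropped
    and \<open>m = 0\<close>. This is the case distinction of
    \<open>vertex_dual_exchange\<close>.\<close>
  obtain m :: real where m: "0 \<le> m" "\<And>j. j \<in> set L \<Longrightarrow> m \<le> real_of_int (fst j)"
    "length oldw = kap a \<or> m = 0"
    "mset neww = mset (real_of_int w # oldw) \<and> m = 0 \<or> mset (m # neww) = mset (real_of_int w # oldw)"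
  proof (cases "length old = kap a")
    case True
    define z where "z = L ! kap a"
    have z: "L = new @ [z]"
      using True len_L by (simp add: new_def z_def take_Suc_conv_app_nth [symmetric])
    have "sorted (map (\<lambda>j. - fst j) L)"
      unfolding L_def by (rule sorted_sort_key)
    then have le: "fst z \<le> fst j" if "j \<in> set L" for j
      using that unfolding z by (auto simp: sorted_append)
    have "mset (real_of_int (fst z) # neww) = mset (real_of_int w # oldw)"
      unfolding mset_Lw [symmetric] by (simp add: z neww_def)
    moreover have "z \<in> set L"
      by (simp add: z)
    ultimately show ?thesis
      using that [of "real_of_int (fst z)"] le nonneg True by (simp add: oldw_def)
  next
    case False
    then have "new = L"
      using len_old len_L by (simp add: new_def)
    then have "mset neww = mset (real_of_int w # oldw)"
      unfolding mset_Lw [symmetric] by (simp add: neww_def)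
    then show ?thesis
      using that [of 0] nonneg by simp
  qed
  have "0 < kap a" "m \<le> real_of_int w"
    using kap_a m(2) [of "(w, e)"] by (simp_all add: set_L)
  have m_old: "m \<le> x" if "x \<in> set oldw" for x
    using that m(2) unfolding oldw_def set_L by (metis (no_types, lifting) imageE insertI2 list.set_map o_apply)
  note exchange = vertex_dual_exchange [OF \<open>0 < kap a\<close> m(1) \<open>m \<le> real_of_int w\<close> m_old m(3,4)]
  show mono: "dual K v \<le> dual (insert_item K (w, e)) v" for v
    using other [of v] exchange(2) dual_a by (cases "v = a") (auto simp: a_def K'_def)
  have "proceeds K = proceeds rest + sum_list oldw"
    using sum_list_mset_cong [of K "rest @ old" "real_of_int \<circ> fst"]
    by (simp add: mset_K proceeds_def oldw_def o_def)
  moreover have "proceeds K' = proceeds rest + sum_list neww"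
    by (simp add: K' proceeds_def neww_def o_def)
  ultimately have proceeds: "proceeds K' - proceeds K = sum_list neww - sum_list oldw"
    by simp
  have "potential K' - potential K = (\<Sum>v\<in>e_right ` set E. real (kap v) * (dual K' v - dual K v))"
    by (simp add: potential_def sum_subtractf right_diff_distrib)
  also have "\<dots> = (\<Sum>v\<in>{a}. real (kap v) * (dual K' v - dual K v))"
    using e other by (intro sum.mono_neutral_right) (auto simp: a_def K'_def)
  finally have potential: "potential K' - potential K = real (kap a) * (dual K' a - dual K a)"
    by simp
  have "real_of_int w - dual K a + (potential K' - potential K)
      \<le> (13/8 + 1 / (2 * real (kap a))) * (proceeds K' - proceeds K)"
    using exchange(1) by (simp add: potential proceeds dual_a)
  also have "\<dots> \<le> greedy_ratio * (proceeds K' - proceeds K)"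
  proof (rule mult_right_mono)
    \<comment> \<open>The capacity bound enters here: \<open>1 / (2 * 22) = 1 / 44\<close>.\<close>
    show "13/8 + 1 / (2 * real (kap a)) \<le> greedy_ratio"
      using kap_a by (simp add: field_simps)
    show "0 \<le> proceeds K' - proceeds K"
      using exchange(3) by (simp add: proceeds)
  qed
  finally show "real_of_int w - dual K (e_right e) + (potential (insert_item K (w, e)) - potential K)
      \<le> greedy_ratio * (proceeds (insert_item K (w, e)) - proceeds K)"
    by (simp add: K'_def a_def)
qed

text \<open>Telescopes \<open>insert_item\<close>. All gains are measured against the duals before
  the first insertion, because these are the ones by which the price was chosen.\<close>

lemma insert_items:
  assumes "valid K" "\<And>i. i \<in> set is \<Longrightarrow> snd i \<in> set E \<and> 0 \<le> fst i"
    and "distinct (map (e_right \<circ> snd) is)"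
  shows "valid (foldl insert_item K is) \<and>
    mset (foldl insert_item K is) \<subseteq># mset is + mset K \<and>
    (\<forall>v. dual K v \<le> dual (foldl insert_item K is) v) \<and>
    (\<Sum>i\<leftarrow>is. real_of_int (fst i) - dual K (e_right (snd i)))
        + (potential (foldl insert_item K is) - potential K)
      \<le> greedy_ratio * (proceeds (foldl insert_item K is) - proceeds K)"
  using assms
proof (induction "is" arbitrary: K)
  case (Cons i "is")
  obtain w e where i: "i = (w, e)"
    by (cases i)
  have e: "e \<in> set E" "0 \<le> w"
    using Cons.prems(2) [of i] by (auto simp: i)
  let ?K = "insert_item K (w, e)" and ?K' = "foldl insert_item (insert_item K (w, e)) is"
  note one = insert_item [OF Cons.prems(1) e]
  have IH: "valid ?K'" "mset ?K' \<subseteq># mset is + mset ?K" "\<forall>v. dual ?K v \<le> dual ?K' v"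
    "(\<Sum>i\<leftarrow>is. real_of_int (fst i) - dual ?K (e_right (snd i))) + (potential ?K' - potential ?K)
      \<le> greedy_ratio * (proceeds ?K' - proceeds ?K)"
    using Cons.IH [OF one(1)] Cons.prems(2,3) by auto
  have "dual ?K (e_right (snd j)) = dual K (e_right (snd j))" if "j \<in> set is" for j
    using that Cons.prems(3) by (intro one(3)) (force simp: i)
  then have "(\<Sum>i\<leftarrow>is. real_of_int (fst i) - dual ?K (e_right (snd i)))
      = (\<Sum>i\<leftarrow>is. real_of_int (fst i) - dual K (e_right (snd i)))"
    by (intro arg_cong [of _ _ sum_list] map_cong) auto
  then have "(real_of_int w - dual K (e_right e))
      + (\<Sum>i\<leftarrow>is. real_of_int (fst i) - dual K (e_right (snd i))) + (potential ?K' - potential K)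
      \<le> greedy_ratio * (proceeds ?K' - proceeds K)"
    using IH(4) one(5) by argo
  moreover have "mset ?K' \<subseteq># mset (i # is) + mset K"
    using subset_mset.trans [OF IH(2) subset_mset.add_left_mono [OF one(2)]] by (simp add: i)
  moreover have "\<forall>v. dual K v \<le> dual ?K' v"
    using IH(3) one(4) order_trans by blast
  ultimately show ?case
    using IH(1) by (simp add: i)
qed simp

lemma candidates:
  assumes "distinct es" "set es \<subseteq> set E"
  shows "distinct (candidates M K es w)"
    and "set (candidates M K es w) = {e \<in> set es. w \<le> e_weight e \<and> dual K (e_right e) < real_of_int w}"
    and "sorted (map (scaled_dual M K) (candidates M K es w))"
proof -
  have "scaled_dual M K e < M * w \<longleftrightarrow> dual K (e_right e) < real_of_int w" if "e \<in> set es" for e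
  proof -
    have "e \<in> set E"
      using that assms(2) by auto
    have "scaled_dual M K e < M * w \<longleftrightarrow> real_of_int (scaled_dual M K e) < real_of_int (M * w)"
      by (simp only: of_int_less_iff)
    also have "\<dots> \<longleftrightarrow> dual K (e_right e) < real_of_int w"
      unfolding scaled_dual_eq [OF \<open>e \<in> set E\<close>] of_int_mult using M_pos by simp
    finally show ?thesis .
  qed
  then show "set (candidates M K es w) = {e \<in> set es. w \<le> e_weight e \<and> dual K (e_right e) < real_of_int w}"
    by (auto simp: candidates_def)
qed (use assms in \<open>simp_all add: candidates_def\<close>)

lemma gain_eq:
  assumes "set es \<subseteq> set E"
  shows "real_of_int (gain M K es c w)
    = M * (\<Sum>e\<leftarrow>chosen M K es c w. real_of_int w - dual K (e_right e))"
proof -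
  have "set (chosen M K es c w) \<subseteq> set E"
    unfolding chosen_def candidates_def
    by (rule subset_trans [OF set_take_subset]) (use assms in auto)
  then have *: "real_of_int (\<Sum>e\<leftarrow>l. M * w - scaled_dual M K e)
      = M * (\<Sum>e\<leftarrow>l. real_of_int w - dual K (e_right e))" if "l = chosen M K es c w" for l
    unfolding that [symmetric] by (induction l) (auto simp: scaled_dual_eq algebra_simps)
  show ?thesis
    unfolding gain_def by (rule *) simp
qed

text \<open>Dual feasibility at one left vertex. For the given price the threshold comes from
  \<open>top_sum_threshold\<close>; edges that are not candidates contribute 0 since
  \<open>\<theta> \<ge> 0\<close>. Maximality of the best price then replaces the gain at
  \<open>w\<close> by the actual \<open>\<alpha>\<close>.\<close>

lemma price_certificate:
  assumes "distinct es" "set es \<subseteq> set E" "w \<in> e_weight ` set es"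
    and alpha: "\<alpha> = (\<Sum>e\<leftarrow>chosen M K es c (best_price M K es c).
      real_of_int (best_price M K es c) - dual K (e_right e))"
  shows "\<exists>\<theta>\<ge>0. real (nat c) * \<theta>
      + (\<Sum>e | e \<in> set es \<and> w \<le> e_weight e. max 0 (real_of_int w - dual K (e_right e) - \<theta>)) \<le> \<alpha>"
proof -
  note cands = candidates [OF assms(1,2), of K w]
  define l where "l = candidates M K es w"
  have "\<exists>\<theta>\<ge>0. real (nat c) * \<theta> + (\<Sum>e\<leftarrow>l. max 0 (real_of_int w - dual K (e_right e) - \<theta>))
      \<le> (\<Sum>e\<leftarrow>take (nat c) l. real_of_int w - dual K (e_right e))"
  proof (rule top_sum_threshold)
    show "sorted (map (scaled_dual M K) l)"
      using cands(3) by (simp add: l_def)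
    show "real_of_int w - dual K (e_right f) \<le> real_of_int w - dual K (e_right e)"
      if "e \<in> set l" "f \<in> set l" "scaled_dual M K e \<le> scaled_dual M K f" for e f
    proof -
      have "e \<in> set E" "f \<in> set E"
        using that cands(2) assms(2) by (auto simp: l_def)
      then have "real_of_int M * dual K (e_right e) \<le> real_of_int M * dual K (e_right f)"
        using that(3) by (simp flip: scaled_dual_eq)
      then show ?thesis
        using M_pos by simp
    qed
    show "0 \<le> real_of_int w - dual K (e_right e)" if "e \<in> set l" for e
      using that cands(2) by (auto simp: l_def)
  qed
  then obtain \<theta> :: real where \<theta>: "0 \<le> \<theta>"
    "real (nat c) * \<theta> + (\<Sum>e\<leftarrow>l. max 0 (real_of_int w - dual K (e_right e) - \<theta>))
      \<le> (\<Sum>e\<leftarrow>take (nat c) l. real_of_int w - dual K (e_right e))"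
    by auto
  have "(\<Sum>e | e \<in> set es \<and> w \<le> e_weight e. max 0 (real_of_int w - dual K (e_right e) - \<theta>))
      = (\<Sum>e\<in>set l. max 0 (real_of_int w - dual K (e_right e) - \<theta>))"
  proof (rule sum.mono_neutral_right)
    show "set l \<subseteq> {e. e \<in> set es \<and> w \<le> e_weight e}"
      unfolding l_def cands(2) by blast
    show "\<forall>e\<in>{e. e \<in> set es \<and> w \<le> e_weight e} - set l. max 0 (real_of_int w - dual K (e_right e) - \<theta>) = 0"
    proof
      fix e assume "e \<in> {e. e \<in> set es \<and> w \<le> e_weight e} - set l"
      then have "\<not> dual K (e_right e) < real_of_int w"
        unfolding l_def cands(2) by blast
      then show "max 0 (real_of_int w - dual K (e_right e) - \<theta>) = 0"
        using \<theta>(1) by simp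
    qed
  qed simp
  also have "\<dots> = (\<Sum>e\<leftarrow>l. max 0 (real_of_int w - dual K (e_right e) - \<theta>))"
    using cands(1) by (simp add: l_def sum_list_distinct_conv_sum_set)
  finally have "real (nat c) * \<theta>
      + (\<Sum>e | e \<in> set es \<and> w \<le> e_weight e. max 0 (real_of_int w - dual K (e_right e) - \<theta>))
      \<le> (\<Sum>e\<leftarrow>chosen M K es c w. real_of_int w - dual K (e_right e))"
    using \<theta>(2) by (simp add: chosen_def l_def)
  also have "\<dots> \<le> \<alpha>"
  proof -
    have "real_of_int M * (\<Sum>e\<leftarrow>chosen M K es c w. real_of_int w - dual K (e_right e)) \<le> real_of_int M * \<alpha>"
      using best_price(2) [OF assms(3), of M K c] unfolding alpha
      by (simp flip: gain_eq [OF assms(2)])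
    then show ?thesis
      using M_pos by simp
  qed
  finally show ?thesis
    using \<theta>(1) by blast
qed

text \<open>A partial solution together with a dual solution for the left vertices treated so far.
  The certificates refer to the current duals and not to those at the time of treatment, so the
  final state yields one feasible dual solution. The entry in \<open>ps\<close> ties the price of an
  item to that of its left end.\<close>

definition invariant :: "(int \<times> int) list \<Rightarrow> item list \<times> (int \<times> int) list \<Rightarrow> bool" where
  "invariant us s \<longleftrightarrow> (case s of (K, ps) \<Rightarrow>
     valid K \<and> distinct (map snd K) \<and> fst ` set ps = fst ` set us \<and> (\<forall>q\<in>set ps. 0 \<le> snd q) \<and>
     (\<forall>i\<in>set K. fst i \<le> e_weight (snd i) \<and> map_of ps (e_left (snd i)) = Some (fst i)) \<and>
     (\<forall>u\<in>set us. length (filter (\<lambda>i. e_left (snd i) = fst u) K) \<le> nat (snd u)) \<and>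
     (\<exists>\<alpha>. (\<Sum>u\<in>fst ` set us. \<alpha> u) + potential K \<le> greedy_ratio * proceeds K \<and>
       (\<forall>u\<in>set us. \<forall>w\<in>e_weight ` {e \<in> set E. e_left e = fst u}.
         \<exists>\<theta>\<ge>0. real (nat (snd u)) * \<theta>
           + (\<Sum>e | e \<in> set E \<and> e_left e = fst u \<and> w \<le> e_weight e.
               max 0 (real_of_int w - dual K (e_right e) - \<theta>)) \<le> \<alpha> (fst u))))"

lemma invariant_step:
  assumes inv: "invariant us s" and new: "fst u \<notin> fst ` set us"
  shows "invariant (us @ [u]) (greedy_step M E s u)"
proof -
  obtain K ps where s: "s = (K, ps)"
    by (cases s)
  define es where "es = filter (\<lambda>e. e_left e = fst u) E"
  define w where "w = best_price M K es (snd u)"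
  define ch where "ch = chosen M K es (snd u) w"
  define K' where "K' = foldl insert_item K (map (Pair w) ch)"
  have step: "greedy_step M E s u = (K', (fst u, w) # ps)"
    by (simp add: greedy_step_def s offers_def w_def ch_def K'_def es_def Let_def)
  obtain \<alpha> where K: "valid K" "distinct (map snd K)"
    and ps: "fst ` set ps = fst ` set us" "\<forall>q\<in>set ps. 0 \<le> snd q"
    and all_price: "\<forall>i\<in>set K. fst i \<le> e_weight (snd i) \<and> map_of ps (e_left (snd i)) = Some (fst i)"
    and all_left: "\<forall>u\<in>set us. length (filter (\<lambda>i. e_left (snd i) = fst u) K) \<le> nat (snd u)"
    and pot: "(\<Sum>u\<in>fst ` set us. \<alpha> u) + potential K \<le> greedy_ratio * proceeds K"
    and all_cert: "\<forall>u\<in>set us. \<forall>w\<in>e_weight ` {e \<in> set E. e_left e = fst u}.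
         \<exists>\<theta>\<ge>0. real (nat (snd u)) * \<theta>
           + (\<Sum>e | e \<in> set E \<and> e_left e = fst u \<and> w \<le> e_weight e.
               max 0 (real_of_int w - dual K (e_right e) - \<theta>)) \<le> \<alpha> (fst u)"
    using inv unfolding invariant_def s prod.case by (elim conjE exE)
  note price = bspec [OF all_price] and left = bspec [OF all_left] and cert = bspec [OF bspec [OF all_cert]]
  have es: "distinct es" "set es = {e \<in> set E. e_left e = fst u}"
    using distinct_E by (auto simp: es_def)
  then have es_E: "set es \<subseteq> set E"
    by auto
  have "set ch \<subseteq> set (candidates M K es w)"
    unfolding ch_def chosen_def by (rule set_take_subset)
  then have ch: "distinct ch" "set ch \<subseteq> {e \<in> set es. w \<le> e_weight e}" "length ch \<le> nat (snd u)"
    using candidates(1,2) [OF es(1) es_E, of K w] by (auto simp: ch_def chosen_def)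
  have w: "0 \<le> w"
    using best_price(1) [of M K es "snd u"] weight_nonneg es_E by (auto simp: w_def)
  have ch_in: "e \<in> set E" "e_left e = fst u" "w \<le> e_weight e" if "e \<in> set ch" for e
    using that ch(2) unfolding es(2) by blast+
  have "inj_on e_right (set ch)"
  proof (rule inj_onI)
    fix e f assume "e \<in> set ch" "f \<in> set ch" "e_right e = e_right f"
    then show "e = f"
      using inj_onD [OF simple, of e f] ch_in [of e] ch_in [of f] by simp
  qed
  then have "distinct (map (e_right \<circ> snd) (map (Pair w) ch))"
    using ch(1) by (simp add: o_def distinct_map)
  moreover have "snd i \<in> set E \<and> 0 \<le> fst i" if "i \<in> set (map (Pair w) ch)" for i
    using that w ch_in(1) unfolding set_map by (elim imageE) simp
  ultimately have K': "valid K'" and sub: "mset K' \<subseteq># mset (map (Pair w) ch) + mset K"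
    and mono: "\<And>v. dual K v \<le> dual K' v"
    and amort: "(\<Sum>e\<leftarrow>ch. real_of_int w - dual K (e_right e)) + (potential K' - potential K)
      \<le> greedy_ratio * (proceeds K' - proceeds K)"
    using insert_items [OF K(1), of "map (Pair w) ch"] by (auto simp: K'_def o_def)
  have in_K': "i \<in> set K \<or> i \<in> Pair w ` set ch" if "i \<in> set K'" for i
    using mset_subset_eqD [OF sub, of i] that by auto
  \<comment> \<open>Kept items have a price entry for their left end, and \<open>u\<close> has none
    yet.\<close>
  have left_K: "e_left (snd i) \<noteq> fst u" if "i \<in> set K" for i
    using price [OF that] new ps(1) by (metis domI dom_map_of_conv_image_fst)
  \<comment> \<open>The inclusion of multisets suffices for the left capacities, since evictions
    only lower these counts.\<close>
  have filter_sub: "length (filter P K') \<le> length (filter P (map (Pair w) ch @ K))" for P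
    using size_mset_mono [OF multiset_filter_mono [OF sub, of P]]
    unfolding mset_append [symmetric] mset_filter [symmetric] size_mset .
  define \<alpha>' where "\<alpha>' = \<alpha>(fst u := (\<Sum>e\<leftarrow>ch. real_of_int w - dual K (e_right e)))"
  \<comment> \<open>Larger duals only weaken the demand on \<open>\<alpha>\<close>, so old
    certificates survive with the same \<open>\<theta>\<close>, and the new one may be computed
    before its items are inserted.\<close>
  have less_dual: "(\<Sum>e | e \<in> set E \<and> e_left e = a \<and> z \<le> e_weight e.
      max 0 (real_of_int z - dual K' (e_right e) - \<theta>))
    \<le> (\<Sum>e | e \<in> set E \<and> e_left e = a \<and> z \<le> e_weight e.
      max 0 (real_of_int z - dual K (e_right e) - \<theta>))" for a z \<theta>
    using mono by (intro sum_mono max.mono) (auto simp: diff_left_mono diff_right_mono)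
  have cert': "\<exists>\<theta>\<ge>0. real (nat (snd x)) * \<theta>
      + (\<Sum>e | e \<in> set E \<and> e_left e = fst x \<and> z \<le> e_weight e.
          max 0 (real_of_int z - dual K' (e_right e) - \<theta>)) \<le> \<alpha>' (fst x)"
    if x: "x \<in> set (us @ [u])" and z: "z \<in> e_weight ` {e \<in> set E. e_left e = fst x}" for x z
  proof -
    have "\<exists>\<theta>\<ge>0. real (nat (snd x)) * \<theta>
      + (\<Sum>e | e \<in> set E \<and> e_left e = fst x \<and> z \<le> e_weight e.
          max 0 (real_of_int z - dual K (e_right e) - \<theta>)) \<le> \<alpha>' (fst x)"
    proof (cases "x \<in> set us")
      case True
      then have "fst x \<noteq> fst u"
        using new True by (metis imageI)
      then show ?thesis
        using cert [OF True z] by (simp add: \<alpha>'_def)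
    next
      case False
      then have "x = u"
        using x by simp
      have eq: "{e. e \<in> set es \<and> z \<le> e_weight e} = {e. e \<in> set E \<and> e_left e = fst u \<and> z \<le> e_weight e}"
        unfolding es(2) by blast
      have "z \<in> e_weight ` set es"
        using z unfolding es(2) \<open>x = u\<close> .
      from price_certificate [OF es(1) es_E this refl, where K = K and c = "snd u", unfolded eq] show ?thesis
        unfolding \<open>x = u\<close> \<alpha>'_def fun_upd_same w_def ch_def .
    qed
    then obtain \<theta> :: real where "0 \<le> \<theta>" "real (nat (snd x)) * \<theta>
      + (\<Sum>e | e \<in> set E \<and> e_left e = fst x \<and> z \<le> e_weight e.
          max 0 (real_of_int z - dual K (e_right e) - \<theta>)) \<le> \<alpha>' (fst x)"
      by (elim exE conjE)
    then show ?thesis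
      using less_dual [of z \<theta> "fst x"] by (intro exI [of _ \<theta>] conjI) linarith+
  qed
  have pot': "(\<Sum>x\<in>fst ` set (us @ [u]). \<alpha>' x) + potential K' \<le> greedy_ratio * proceeds K'"
  proof -
    have "(\<Sum>x\<in>fst ` set (us @ [u]). \<alpha>' x) = \<alpha>' (fst u) + (\<Sum>x\<in>fst ` set us. \<alpha>' x)"
      using new by simp
    also have "(\<Sum>x\<in>fst ` set us. \<alpha>' x) = (\<Sum>x\<in>fst ` set us. \<alpha> x)"
      unfolding \<alpha>'_def using new by (intro sum.cong refl fun_upd_other) metis
    finally show ?thesis
      using pot amort by (simp add: \<alpha>'_def algebra_simps)
  qed
  show ?thesis
    unfolding step invariant_def prod.case
  proof (intro conjI ballI)
    have "distinct (map snd (map (Pair w) ch @ K))"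
      using ch(1) K(2) left_K ch_in(2) by (fastforce simp: o_def)
    moreover have "mset (map snd K') \<subseteq># mset (map snd (map (Pair w) ch @ K))"
      using image_mset_subseteq_mono [OF sub, of snd] by (simp del: map_map)
    ultimately show "distinct (map snd K')"
      by (rule distinct_mset_mono [rotated])
    show "fst ` set ((fst u, w) # ps) = fst ` set (us @ [u])"
      using ps(1) by auto
    show "fst i \<le> e_weight (snd i)" "map_of ((fst u, w) # ps) (e_left (snd i)) = Some (fst i)"
      if "i \<in> set K'" for i
      using in_K' [OF that] price [of i] left_K [of i] ch_in [of "snd i"] by fastforce+
    show "length (filter (\<lambda>i. e_left (snd i) = fst x) K') \<le> nat (snd x)" if "x \<in> set (us @ [u])" for x
    proof (cases "x \<in> set us")
      case True
      then have "fst x \<noteq> fst u"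
        using new True by (metis imageI)
      then have "filter (\<lambda>i. e_left (snd i) = fst x) (map (Pair w) ch) = []"
        using ch_in(2) by (auto simp: filter_empty_conv)
      then show ?thesis
        using filter_sub [of "\<lambda>i. e_left (snd i) = fst x"] left [OF True] by simp
    next
      case False
      then have "x = u"
        using that by simp
      moreover have "filter (\<lambda>i. e_left (snd i) = fst u) K = []"
        using left_K by (auto simp: filter_empty_conv)
      moreover have "length (filter P (map (Pair w) ch)) \<le> nat (snd u)" for P
        by (rule order_trans [OF length_filter_le]) (simp add: ch(3))
      ultimately show ?thesis
        using order_trans [OF filter_sub [of "\<lambda>i. e_left (snd i) = fst x"]]
        unfolding filter_append length_append by simp
    qed
    show "\<exists>\<alpha>. (\<Sum>u\<in>fst ` set (us @ [u]). \<alpha> u) + potential K' \<le> greedy_ratio * proceeds K' \<and>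
       (\<forall>u\<in>set (us @ [u]). \<forall>w\<in>e_weight ` {e \<in> set E. e_left e = fst u}.
         \<exists>\<theta>\<ge>0. real (nat (snd u)) * \<theta>
           + (\<Sum>e | e \<in> set E \<and> e_left e = fst u \<and> w \<le> e_weight e.
               max 0 (real_of_int w - dual K' (e_right e) - \<theta>)) \<le> \<alpha> (fst u))"
      using pot' cert' by (intro exI [of _ \<alpha>'] conjI ballI)
  qed (use K' ps(2) w in auto)
qed

lemma dual_Nil [simp]: "dual [] v = 0"
  by (simp add: dual_def kept_weights_def vertex_dual_def min_sum_def)

lemma invariant_greedy:
  assumes "distinct (map fst us)"
  shows "invariant us (greedy M E us)"
  using assms
proof (induction us rule: rev_induct)
  case Nil
  show ?case
    by (auto simp: greedy_def invariant_def valid_def proceeds_def potential_def)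
next
  case (snoc u us)
  then show ?case
    using invariant_step [of us "greedy M E us" u] by (simp add: greedy_def)
qed

lemma vertex_dual_nonneg: "(\<And>x. x \<in> set ws \<Longrightarrow> 0 \<le> x) \<Longrightarrow> 0 \<le> vertex_dual k ws"
  unfolding vertex_dual_def min_sum_def
  by (intro divide_nonneg_nonneg add_nonneg_nonneg mult_nonneg_nonneg sum_list_nonneg)
    (auto intro!: sum_list_nonneg)

lemma dual_nonneg: "valid K \<Longrightarrow> 0 \<le> dual K v"
  unfolding dual_def by (rule vertex_dual_nonneg) (auto simp: kept_weights_def valid_def)

end

section \<open>Running time of the greedy algorithm\<close>

lemma polytime_kept_weights [polytime_intros]:
  assumes "polytime K" "polytime v"
  shows "polytime (\<lambda>x. kept_weights (K x) (v x))"
  unfolding kept_weights_def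
  by (intro polytime_intros assms polytime_comp [OF assms(2)])

lemma polytime_min_sum [polytime_intros]:
  fixes l :: "'a::enc \<Rightarrow> int list"
  assumes "polytime l"
  shows "polytime (\<lambda>x. min_sum (l x))"
  unfolding min_sum_def
  by (intro polytime_intros assms polytime_comp [OF assms])

lemma polytime_scaled_dual [polytime_intros]:
  assumes "polytime M" "polytime K" "polytime e"
  shows "polytime (\<lambda>x. scaled_dual (M x) (K x) (e x))"
  unfolding scaled_dual_def by (intro polytime_intros assms)

lemma polytime_candidates [polytime_intros]:
  assumes "polytime M" "polytime K" "polytime es" "polytime w"
  shows "polytime (\<lambda>x. candidates (M x) (K x) (es x) (w x))"
  unfolding candidates_def
  by (intro polytime_intros assms assms(1,2,4) [THEN polytime_comp])

lemma polytime_chosen [polytime_intros]: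
  assumes "polytime M" "polytime K" "polytime es" "polytime c" "polytime w"
  shows "polytime (\<lambda>x. chosen (M x) (K x) (es x) (c x) (w x))"
  unfolding chosen_def by (intro polytime_intros assms)

lemma polytime_gain [polytime_intros]:
  assumes "polytime M" "polytime K" "polytime es" "polytime c" "polytime w"
  shows "polytime (\<lambda>x. gain (M x) (K x) (es x) (c x) (w x))"
  unfolding gain_def by (intro polytime_intros assms assms(1,2,5) [THEN polytime_comp])

lemma polytime_best_price [polytime_intros]:
  assumes "polytime M" "polytime K" "polytime es" "polytime c"
  shows "polytime (\<lambda>x. best_price (M x) (K x) (es x) (c x))"
  unfolding best_price_def
  by (intro polytime_hd_nonempty polytime_intros assms assms [THEN polytime_comp])
    (simp add: insort_not_Nil)

lemma polytime_offers [polytime_intros]: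
  assumes "polytime M" "polytime K" "polytime es" "polytime c"
  shows "polytime (\<lambda>x. offers (M x) (K x) (es x) (c x))"
  unfolding offers_def by (intro polytime_intros assms assms [THEN polytime_comp])

lemma polytime_insert_item [polytime_intros]:
  assumes "polytime K" "polytime i"
  shows "polytime (\<lambda>x. insert_item (K x) (i x))"
  unfolding insert_item_def by (intro polytime_intros assms assms(2) [THEN polytime_comp])

text \<open>Splitting \<open>K\<close> by the right end, sorting and truncating create no new
  entries. The growth is thus additive, as \<open>polytime_foldl\<close> requires.\<close>

lemma sz_insert_item: "sz (insert_item K i) \<le> sz K + sz i + 1"
proof -
  define old where "old = filter (\<lambda>j. e_right (snd j) = e_right (snd i)) K"
  define rest where "rest = filter (\<lambda>j. e_right (snd j) \<noteq> e_right (snd i)) K"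
  define L where "L = sort_key (\<lambda>j. - fst j) (i # old)"
  have "sz (insert_item K i) + 1 = sz rest + sz (take (nat (e_cap (snd i))) L)"
    unfolding insert_item_def old_def [symmetric] rest_def [symmetric] L_def [symmetric]
    by (rule sz_append)
  moreover have "sz (take (nat (e_cap (snd i))) L) \<le> sz (i # old)"
  proof -
    have "mset L = mset (i # old)"
      unfolding L_def by (rule mset_sort)
    then have "sz L \<le> sz (i # old)"
      by (intro sz_mset_mono) simp
    then show ?thesis
      by (rule order_trans [OF sz_take])
  qed
  moreover have "sz rest + sz old \<le> sz K + 1"
  proof -
    have "mset (rest @ old) = mset K"
      using multiset_partition [of "mset K" "\<lambda>j. e_right (snd j) \<noteq> e_right (snd i)"]
      by (simp add: rest_def old_def)
    then have "sz (rest @ old) \<le> sz K"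
      by (intro sz_mset_mono) simp
    then show ?thesis
      using sz_append [of rest old] by linarith
  qed
  ultimately show ?thesis
    by simp
qed

lemma polytime_insert_items [polytime_intros]:
  assumes "polytime K" "polytime l"
  shows "polytime (\<lambda>x. foldl insert_item (K x) (l x))"
proof (rule polytime_foldl [where Q = "[:1, 1:]"])
  show "sz (insert_item s a) \<le> sz s + poly [:1, 1:] (sz x + sz a)" for x :: 'a and s a
    using sz_insert_item [of s a] by simp
qed (intro polytime_intros assms)+

lemma polytime_greedy_step [polytime_intros]:
  assumes "polytime M" "polytime E" "polytime s" "polytime u"
  shows "polytime (\<lambda>x. greedy_step (M x) (E x) (s x) (u x))"
  unfolding greedy_step_def
  by (intro polytime_intros assms assms [THEN polytime_comp])

lemma sz_foldl_insert_item: "sz (foldl insert_item K is) \<le> sz K + sz is"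
proof (induction "is" arbitrary: K)
  case (Cons i "is")
  show ?case
    using Cons [of "insert_item K i"] sz_insert_item [of K i] by simp
qed simp

text \<open>A price is 0 or a weight occurring in \<open>E\<close>, so its size is bounded
  independently of the state. Every offer carries a copy of the price, which accounts for the
  square.\<close>

lemma sz_greedy_step: "sz (greedy_step M E s u) \<le> sz s + (3 + 4 * sz E + (sz E)\<^sup>2 + sz u)"
proof -
  define es where "es = filter (\<lambda>e. e_left e = fst u) E"
  define w where "w = best_price M (fst s) es (snd u)"
  define ch where "ch = chosen M (fst s) es (snd u) w"
  have step: "greedy_step M E s u = (foldl insert_item (fst s) (map (Pair w) ch), (fst u, w) # snd s)"
    by (simp add: greedy_step_def offers_def w_def ch_def es_def Let_def)
  have "sz w \<le> 1 + sz E"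
  proof (cases "w = 0")
    case True
    then show ?thesis
      by (simp add: enc_simps floorlog_def)
  next
    case False
    then obtain e where e: "e \<in> set es" "w = e_weight e"
      using best_price(1) [of M "fst s" es "snd u"] by (auto simp: w_def)
    have "sz (e_weight e) \<le> sz e"
      by (meson sz_fst sz_snd order_trans)
    also have "\<dots> \<le> sz E"
      using e(1) by (intro sz_member) (simp add: es_def)
    finally show ?thesis
      using e(2) by simp
  qed
  have "mset (candidates M (fst s) es w) \<subseteq># mset E"
    unfolding candidates_def es_def by (auto intro: subset_mset.trans multiset_filter_subset)
  then have "sz (candidates M (fst s) es w) \<le> sz E"
    by (rule sz_mset_mono)
  then have ch: "sz ch \<le> sz E"
    unfolding ch_def chosen_def by (rule order_trans [OF sz_take])
  have "sz (map (Pair w) l) = sz l + length l * (1 + sz w)" for l :: "edge_rec list"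
    by (induction l) auto
  then have "sz (map (Pair w) ch) = sz ch + length ch * (1 + sz w)"
    by this
  also have "\<dots> \<le> sz E + sz E * (2 + sz E)"
    using ch \<open>sz w \<le> 1 + sz E\<close> length_le_sz [of ch]
    by (intro add_mono [of "sz ch"] mult_mono [of "length ch"]) simp_all
  finally have "sz (foldl insert_item (fst s) (map (Pair w) ch)) \<le> sz (fst s) + (sz E + sz E * (2 + sz E))"
    using sz_foldl_insert_item [of "fst s" "map (Pair w) ch"] by linarith
  moreover have "sz (greedy_step M E s u)
      = 1 + sz (foldl insert_item (fst s) (map (Pair w) ch)) + (1 + (1 + sz (fst u) + sz w) + sz (snd s))"
    unfolding step by simp
  moreover have "sz s = 1 + sz (fst s) + sz (snd s)"
    by (cases s) simp
  ultimately show ?thesis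
    using \<open>sz w \<le> 1 + sz E\<close> sz_fst [of u] by (simp add: power2_eq_square algebra_simps)
qed

lemma polytime_greedy [polytime_intros]:
  assumes "polytime M" "polytime E" "polytime us"
  shows "polytime (\<lambda>x. greedy (M x) (E x) (us x))"
proof -
  have "polytime (\<lambda>x. foldl (greedy_step (fst x) (fst (snd x))) ([], []) (snd (snd x)))"
  proof (rule polytime_foldl [where Q = "[:3, 5, 1:]"])
    fix x :: "int \<times> edge_rec list \<times> (int \<times> int) list" and s and a :: "int \<times> int"
    have "sz (fst (snd x)) \<le> sz x"
      by (meson sz_fst sz_snd order_trans)
    then have le: "sz (fst (snd x)) \<le> sz x + sz a" "sz a \<le> sz x + sz a"
      by simp_all
    have "(sz (fst (snd x)))\<^sup>2 \<le> (sz x + sz a)\<^sup>2"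
      using le(1) by (rule power_mono) simp
    then show "sz (greedy_step (fst x) (fst (snd x)) s a) \<le> sz s + poly [:3, 5, 1:] (sz x + sz a)"
      using sz_greedy_step [of "fst x" "fst (snd x)" s a] le
      by (simp add: power2_eq_square algebra_simps)
  qed (intro polytime_intros)+
  from polytime_comp [OF this polytime_on_Pair [OF assms(1) polytime_on_Pair [OF assms(2,3)]]]
  show ?thesis
    by (simp add: greedy_def)
qed

section \<open>Solving an encoded instance\<close>

type_synonym input_edge = "int \<times> int \<times> int \<times> int \<times> int \<times> unit"
type_synonym input = "(int \<times> enat) list \<times> (int \<times> enat) list \<times> input_edge list \<times> unit"

abbreviation i_left :: "input \<Rightarrow> (int \<times> enat) list" where "i_left z \<equiv> fst z"
abbreviation i_right :: "input \<Rightarrow> (int \<times> enat) list" where "i_right z \<equiv> fst (snd z)"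
abbreviation i_edges :: "input \<Rightarrow> input_edge list" where "i_edges z \<equiv> fst (snd (snd z))"
abbreviation i_num :: "input_edge \<Rightarrow> int" where "i_num e \<equiv> fst (snd (snd (snd e)))"
abbreviation i_den :: "input_edge \<Rightarrow> int" where "i_den e \<equiv> fst (snd (snd (snd (snd e))))"

text \<open>The number of edges makes the replaced capacity harmless; the 22 preserves the lower
  bound on capacities if there are few edges.\<close>

definition finite_cap :: "input \<Rightarrow> enat \<Rightarrow> int" where
  "finite_cap z c = (case c of enat k \<Rightarrow> int k | \<infinity> \<Rightarrow> int (length (i_edges z)) + 22)"

text \<open>A table lookup in the form of a sum: the names are distinct, so at most one entry has
  the key.\<close>

definition right_cap :: "input \<Rightarrow> int \<Rightarrow> int" where
  "right_cap z v = sum_list (map (\<lambda>q. finite_cap z (snd q)) (filter (\<lambda>q. fst q = v) (i_right z)))"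

text \<open>A plain product, not a least common multiple: its size is still polynomial in the input,
  and every denominator divides it.\<close>

definition common_den :: "input \<Rightarrow> int" where
  "common_den z = prod_list (map i_den (i_edges z))"

definition edge_recs :: "input \<Rightarrow> edge_rec list" where
  "edge_recs z = map (\<lambda>e. (fst e, fst (snd e), fst (snd (snd e)), i_num e * (common_den z div i_den e),
     right_cap z (fst (snd (snd e))))) (i_edges z)"

definition multiplier :: "edge_rec list \<Rightarrow> int" where
  "multiplier E = prod_list (map (\<lambda>e. 2 * e_cap e * e_cap e) E)"

definition solution :: "input \<Rightarrow> item list \<times> (int \<times> int) list" where
  "solution z = greedy (multiplier (edge_recs z)) (edge_recs z)
     (map (\<lambda>q. (fst q, finite_cap z (snd q))) (i_left z))"

definition solve :: "input \<Rightarrow> (int \<times> int \<times> int) list \<times> int list" where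
  "solve z = (map (\<lambda>q. (fst q, snd q, common_den z)) (snd (solution z)),
     map (\<lambda>i. e_id (snd i)) (fst (solution z)))"

section \<open>Running time of the whole computation\<close>

lemma polytime_finite_cap [polytime_intros]:
  assumes "polytime z" "polytime c"
  shows "polytime (\<lambda>x. finite_cap (z x) (c x))"
  unfolding finite_cap_def by (intro polytime_intros assms)

lemma polytime_right_cap [polytime_intros]:
  assumes "polytime z" "polytime v"
  shows "polytime (\<lambda>x. right_cap (z x) (v x))"
  unfolding right_cap_def by (intro polytime_intros assms assms [THEN polytime_comp])

lemma polytime_common_den [polytime_intros]: "polytime z \<Longrightarrow> polytime (\<lambda>x. common_den (z x))"
  unfolding common_den_def by (intro polytime_intros)

lemma polytime_edge_recs [polytime_intros]:
  assumes "polytime z"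
  shows "polytime (\<lambda>x. edge_recs (z x))"
  unfolding edge_recs_def by (intro polytime_intros assms assms [THEN polytime_comp])

lemma polytime_multiplier [polytime_intros]: "polytime E \<Longrightarrow> polytime (\<lambda>x. multiplier (E x))"
  unfolding multiplier_def by (intro polytime_intros)

lemma polytime_solution [polytime_intros]:
  assumes "polytime z"
  shows "polytime (\<lambda>x. solution (z x))"
  unfolding solution_def by (intro polytime_intros assms assms [THEN polytime_comp])

lemma polytime_solve: "polytime solve"
  unfolding solve_def [abs_def] by (intro polytime_intros)

section \<open>Correctness of the computed solution for an encoded instance\<close>

locale pricing_encoding =
  fixes I :: "(nat, nat) pricing_instance" and us vs es :: "nat list" and num den :: "nat \<Rightarrow> int"
  assumes wf: "wf_instance I" and simple: "simple_instance I"
    and cap_ge: "\<And>w. w \<in> lside I \<union> rside I \<Longrightarrow> 22 \<le> cap I w"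
    and us: "distinct us" "set us = lside I"
    and vs: "distinct vs" "set vs = rside I"
    and es: "distinct es" "set es = edges I"
    and den_pos: "\<And>e. e \<in> edges I \<Longrightarrow> 0 < den e"
    and budget: "\<And>e. e \<in> edges I \<Longrightarrow> budget I e = real_of_int (num e) / real_of_int (den e)"
begin

definition z :: input where
  "z = (map (\<lambda>u. (int u, cap I u)) us, map (\<lambda>v. (int v, cap I v)) vs,
     map (\<lambda>e. (int e, int (lend I e), int (rend I e), num e, den e, ())) es, ())"

lemma enc_z: "enc z = list_val
   [list_val (map (\<lambda>u. VPair (nat_val u) (cap_val (cap I u))) us),
    list_val (map (\<lambda>v. VPair (nat_val v) (cap_val (cap I v))) vs),
    list_val (map (\<lambda>e. list_val
      [nat_val e, nat_val (lend I e), nat_val (rend I e), VNum (num e), VNum (den e)]) es)]"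
  by (simp add: z_def enc_simps enc_list_def nat_val_def o_def) (simp add: list_val_def)

definition D :: int where "D = common_den z"

definition fcap :: "nat \<Rightarrow> nat" where
  "fcap w = (case cap I w of enat k \<Rightarrow> k | \<infinity> \<Rightarrow> length es + 22)"

definition rec :: "nat \<Rightarrow> edge_rec" where
  "rec e = (int e, int (lend I e), int (rend I e), num e * (D div den e), int (fcap (rend I e)))"

definition E :: "edge_rec list" where "E = edge_recs z"

lemma finite_cap_eq: "finite_cap z (cap I w) = int (fcap w)"
  by (cases "cap I w") (auto simp: finite_cap_def fcap_def z_def)

lemma fcap: "w \<in> lside I \<union> rside I \<Longrightarrow> cap I w = enat (fcap w) \<or> cap I w = \<infinity> \<and> card (edges I) \<le> fcap w"
  using es by (cases "cap I w") (auto simp: fcap_def distinct_card [symmetric])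

lemma fcap_ge: "w \<in> lside I \<union> rside I \<Longrightarrow> 22 \<le> fcap w"
  using cap_ge [of w] by (cases "cap I w") (auto simp: fcap_def numeral_eq_enat)

lemma ends: "e \<in> edges I \<Longrightarrow> lend I e \<in> lside I" "e \<in> edges I \<Longrightarrow> rend I e \<in> rside I"
  and disjoint: "lside I \<inter> rside I = {}"
  and budget_nonneg: "e \<in> edges I \<Longrightarrow> 0 \<le> budget I e"
  and finite_sides: "finite (lside I)" "finite (rside I)" "finite (edges I)"
  using wf by (auto simp: wf_instance_def)

lemma right_cap_eq:
  assumes "v \<in> rside I"
  shows "right_cap z (int v) = int (fcap v)"
proof -
  have "filter (\<lambda>q. fst q = int v) (map (\<lambda>v. (int v, cap I v)) l) = (if v \<in> set l then [(int v, cap I v)] else [])"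
    if "distinct l" for l
    using that by (induction l) auto
  from this [OF vs(1)] show ?thesis
    using vs(2) assms by (simp add: right_cap_def z_def finite_cap_eq [unfolded z_def])
qed

lemma E_eq: "E = map rec es"
  using es ends by (auto simp: E_def edge_recs_def rec_def D_def z_def o_def right_cap_eq [unfolded z_def])

lemma inj_rec: "inj rec"
  by (auto simp: rec_def inj_def)

lemma set_E: "set E = rec ` edges I"
  by (simp add: E_eq es)

lemma rec_sel [simp]: "e_id (rec e) = int e" "e_left (rec e) = int (lend I e)"
  "e_right (rec e) = int (rend I e)" "e_cap (rec e) = int (fcap (rend I e))"
  by (simp_all add: rec_def)

lemma D_pos: "0 < D"
proof -
  have "0 < prod_list (map den l)" if "set l \<subseteq> edges I" for l
    using that den_pos by (induction l) auto
  from this [of es] show ?thesis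
    using es by (simp add: D_def common_den_def z_def o_def)
qed

lemma weight_rec:
  assumes e: "e \<in> edges I"
  shows "real_of_int (e_weight (rec e)) = D * budget I e"
proof -
  have "den e dvd D"
    using e es by (auto simp: D_def common_den_def z_def o_def intro!: prod_list_dvd)
  then show ?thesis
    using den_pos [OF e] by (simp add: rec_def budget [OF e] real_of_int_div)
qed

sublocale greedy_pricing "multiplier E" E "\<lambda>v. fcap (nat v)"
proof
  have cap_pos: "0 < 2 * e_cap e * e_cap e" if "e \<in> set E" for e
    using that fcap_ge ends unfolding set_E by (force intro: mult_pos_pos)
  show "distinct E"
    using es(1) by (simp add: E_eq distinct_map inj_on_subset [OF inj_rec])
  show "inj_on (\<lambda>e. (e_left e, e_right e)) (set E)"
    using simple unfolding set_E by (auto simp: simple_instance_def inj_on_def)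
  show "e_cap e = int (fcap (nat (e_right e)))" "22 \<le> fcap (nat (e_right e))" if "e \<in> set E" for e
    using that fcap_ge ends unfolding set_E by auto
  have "0 < multiplier l" if "set l \<subseteq> set E" for l
    using that cap_pos by (induction l) (auto simp: multiplier_def)
  then show "0 < multiplier E"
    by simp
  show "2 * e_cap e * e_cap e dvd multiplier E" if "e \<in> set E" for e
    using that by (auto simp: multiplier_def intro!: prod_list_dvd)
  show "0 \<le> e_weight e" if "e \<in> set E" for e
  proof -
    obtain f where f: "f \<in> edges I" "e = rec f"
      using \<open>e \<in> set E\<close> unfolding set_E by blast
    have "0 \<le> real_of_int (e_weight e)"
      using D_pos budget_nonneg [OF f(1)] by (simp add: f(2) weight_rec [OF f(1)])
    then show ?thesis
      by simp
  qed
qed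

definition K :: "item list" where "K = fst (solution z)"
definition ps :: "(int \<times> int) list" where "ps = snd (solution z)"
definition F :: "nat set" where "F = {e. rec e \<in> snd ` set K}"
definition p :: "nat \<Rightarrow> real" where
  "p w = (case map_of ps (int w) of None \<Rightarrow> 0 | Some a \<Rightarrow> real_of_int a / real_of_int D)"

lemma invariant: "invariant (map (\<lambda>u. (int u, int (fcap u))) us) (K, ps)"
proof -
  have "map (\<lambda>q. (fst q, finite_cap z (snd q))) (i_left z) = map (\<lambda>u. (int u, int (fcap u))) us"
    unfolding finite_cap_eq [symmetric] by (simp add: z_def)
  then have "(K, ps) = greedy (multiplier E) E (map (\<lambda>u. (int u, int (fcap u))) us)"
    by (simp add: K_def ps_def solution_def E_def)
  then show ?thesis
    using us(1) by (simp add: invariant_greedy distinct_map o_def inj_on_def)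
qed

lemma valid_K: "valid K"
  and distinct_K: "distinct (map snd K)"
  and ps_keys: "fst ` set ps = int ` lside I"
  and ps_nonneg: "\<And>q. q \<in> set ps \<Longrightarrow> 0 \<le> snd q"
  and K_weight: "\<And>i. i \<in> set K \<Longrightarrow> fst i \<le> e_weight (snd i)"
  and K_price: "\<And>i. i \<in> set K \<Longrightarrow> map_of ps (e_left (snd i)) = Some (fst i)"
  and K_left: "\<And>u. u \<in> lside I \<Longrightarrow> length (filter (\<lambda>i. e_left (snd i) = int u) K) \<le> fcap u"
  using invariant us(2) unfolding invariant_def prod.case by (auto simp: image_image)

lemma price_list_eq: "price_list (enc (map (\<lambda>q. (fst q, snd q, D)) qs)) w
    = (case map_of qs (int w) of None \<Rightarrow> 0 | Some a \<Rightarrow> real_of_int a / real_of_int D)"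
  by (induction qs) (auto simp: enc_simps)

lemma edge_set_eq: "edge_set (enc (ids :: int list)) = {e. int e \<in> set ids}"
  by (induction ids) (auto simp: enc_simps)

lemma sol_price_solve: "sol_price (enc (solve z)) = p"
  by (auto simp: sol_price_def solve_def enc_prod_def D_def [symmetric] price_list_eq p_def ps_def fun_eq_iff)

lemma K_recs: "snd ` set K \<subseteq> rec ` edges I"
  using valid_K by (auto simp: valid_def set_E)

lemma K_rec:
  assumes "i \<in> set K"
  obtains e where "e \<in> edges I" "snd i = rec e"
  using subsetD [OF K_recs imageI [OF assms]] by (elim imageE)

lemma sol_edges_solve: "sol_edges (enc (solve z)) = F"
proof -
  have "int e \<in> (\<lambda>i. e_id (snd i)) ` set K \<longleftrightarrow> rec e \<in> snd ` set K" for e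
  proof
    assume "int e \<in> (\<lambda>i. e_id (snd i)) ` set K"
    then obtain i where i: "i \<in> set K" "int e = e_id (snd i)"
      by blast
    obtain f where "snd i = rec f"
      using K_rec [OF i(1)] .
    then show "rec e \<in> snd ` set K"
      using i by (metis image_eqI of_nat_eq_iff rec_sel(1))
  next
    assume "rec e \<in> snd ` set K"
    then obtain i where "i \<in> set K" "rec e = snd i"
      by blast
    then show "int e \<in> (\<lambda>i. e_id (snd i)) ` set K"
      by (metis image_eqI rec_sel(1))
  qed
  then show ?thesis
    by (simp add: sol_edges_def solve_def enc_prod_def edge_set_eq F_def K_def)
qed

text \<open>The kept records are exactly those of sold edges, and \<open>rec\<close> is injective.
  Sums over \<open>F\<close> can therefore be read off the list \<open>K\<close>.\<close>

lemma rec_F: "rec ` F = snd ` set K"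
proof -
  have "rec ` F = rec ` (rec -` (snd ` set K))"
    by (simp only: F_def vimage_def)
  also have "\<dots> = snd ` set K"
    unfolding image_vimage_eq by (rule Int_absorb2) (rule subset_trans [OF K_recs image_mono [OF subset_UNIV]])
  finally show ?thesis .
qed

lemma F_edges: "F \<subseteq> edges I"
proof
  fix e assume "e \<in> F"
  then have "rec e \<in> rec ` edges I"
    unfolding F_def mem_Collect_eq by (rule subsetD [OF K_recs])
  then show "e \<in> edges I"
    by (simp only: inj_image_mem_iff [OF inj_rec])
qed

lemma F_item:
  assumes "e \<in> F"
  obtains i where "i \<in> set K" "snd i = rec e"
  using assms by (auto simp: F_def)

lemma card_F_le:
  assumes "\<And>e. e \<in> F \<Longrightarrow> Q e \<Longrightarrow> P (rec e)"
  shows "card {e \<in> F. Q e} \<le> length (filter (\<lambda>i. P (snd i)) K)"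
proof -
  have "card {e \<in> F. Q e} = card (rec ` {e \<in> F. Q e})"
    using inj_rec by (simp add: card_image inj_on_subset)
  also have "\<dots> \<le> card (set (map snd (filter (\<lambda>i. P (snd i)) K)))"
  proof (rule card_mono)
    show "rec ` {e \<in> F. Q e} \<subseteq> set (map snd (filter (\<lambda>i. P (snd i)) K))"
    proof
      fix r assume "r \<in> rec ` {e \<in> F. Q e}"
      then obtain e where e: "e \<in> F" "Q e" "r = rec e"
        by blast
      obtain i where "i \<in> set K" "snd i = rec e"
        using F_item [OF e(1)] by blast
      then have "i \<in> set (filter (\<lambda>i. P (snd i)) K)"
        using assms [OF e(1,2)] by simp
      then show "r \<in> set (map snd (filter (\<lambda>i. P (snd i)) K))"
        unfolding e(3) \<open>snd i = rec e\<close> [symmetric] set_map by (rule imageI)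
    qed
  qed simp
  also have "\<dots> \<le> length (filter (\<lambda>i. P (snd i)) K)"
    by (metis card_length length_map)
  finally show ?thesis .
qed

lemma p_right: "v \<in> rside I \<Longrightarrow> p v = 0"
proof -
  assume "v \<in> rside I"
  then have "int v \<notin> fst ` set ps"
    using disjoint unfolding ps_keys by auto
  then show ?thesis
    by (simp add: p_def map_of_eq_None_iff [THEN iffD2])
qed

lemma p_left:
  assumes "i \<in> set K" "snd i = rec e"
  shows "p (lend I e) = real_of_int (fst i) / real_of_int D"
  using K_price [OF assms(1)] assms(2) by (simp add: p_def)

lemma feasible: "feasible I p F"
  unfolding feasible_def
proof (intro conjI ballI)
  show "0 \<le> p w" for w
    using ps_nonneg D_pos by (force simp: p_def split: option.split dest: map_of_SomeD)
  show "p v = 0" if "v \<in> rside I" for v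
    using that by (rule p_right)
  show "F \<subseteq> edges I"
    by (rule F_edges)
  show "p (lend I e) + p (rend I e) \<le> budget I e" if e: "e \<in> F" for e
  proof -
    have "e \<in> edges I"
      using e F_edges by blast
    obtain i where i: "i \<in> set K" "snd i = rec e"
      using F_item [OF e] .
    have "real_of_int (fst i) \<le> D * budget I e"
      using K_weight [OF i(1)] weight_rec [OF \<open>e \<in> edges I\<close>] unfolding i(2) by linarith
    then show ?thesis
      using D_pos p_right [OF ends(2) [OF \<open>e \<in> edges I\<close>]] p_left [OF i]
      by (simp add: divide_le_eq mult.commute)
  qed
  show "enat (card (F \<inter> incident I w)) \<le> cap I w" if w: "w \<in> lside I \<union> rside I" for w
  proof -
    have "card (F \<inter> incident I w) \<le> fcap w"
    proof (cases "w \<in> lside I")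
      case True
      then have "F \<inter> incident I w = {e \<in> F. lend I e = w}"
        using F_edges by (auto simp: incident_lside [OF wf])
      also have "card \<dots> \<le> length (filter (\<lambda>i. e_left (snd i) = int w) K)"
        by (rule card_F_le) simp
      finally show ?thesis
        using K_left [OF True] by simp
    next
      case False
      then have "w \<in> rside I"
        using w by blast
      then have eq: "F \<inter> incident I w = {e \<in> F. rend I e = w}"
        using F_edges by (auto simp: incident_rside [OF wf])
      show ?thesis
      proof (cases "int w \<in> e_right ` set E")
        case True
        have "card {e \<in> F. rend I e = w} \<le> length (filter (\<lambda>i. e_right (snd i) = int w) K)"
          by (rule card_F_le) simp
        also have "\<dots> \<le> fcap w"
          using valid_K True unfolding valid_def by (metis nat_int)
        finally show ?thesis
          by (simp add: eq)
      next
        \<comment> \<open>\<open>valid\<close> bounds the load only at right ends of edges; any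
          other right vertex meets no edge of \<open>F\<close>.\<close>
        case False
        have "{e \<in> F. rend I e = w} = {}"
        proof (rule equals0I)
          fix e assume "e \<in> {e \<in> F. rend I e = w}"
          then have "rec e \<in> set E" "e_right (rec e) = int w"
            using F_edges unfolding set_E by auto
          then show False
            using False by (metis imageI)
        qed
        then show ?thesis
          unfolding eq by (simp only: card.empty le0)
      qed
    qed
    then show ?thesis
      using fcap [OF w] by (metis enat_ord_code(3) enat_ord_simps(1))
  qed
qed

text \<open>The right ends have price 0, each left end has the price of its items, and no edge is
  kept twice; so the sum over the set \<open>F\<close> is the sum over the list
  \<open>K\<close>.\<close>

lemma revenue: "revenue I p F = proceeds K / D"
proof -
  have "revenue I p F = (\<Sum>e\<in>F. p (lend I e))"
    unfolding revenue_def using F_edges ends p_right by (intro sum.cong) auto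
  also have "\<dots> = (\<Sum>e\<in>F. p (nat (e_left (rec e))))"
    by simp
  also have "\<dots> = (\<Sum>r\<in>rec ` F. p (nat (e_left r)))"
    using inj_rec by (subst sum.reindex) (auto simp: inj_on_def inj_def)
  also have "\<dots> = (\<Sum>r\<in>set (map snd K). p (nat (e_left r)))"
    by (simp add: rec_F)
  also have "\<dots> = (\<Sum>r\<leftarrow>map snd K. p (nat (e_left r)))"
    using distinct_K by (rule sum_list_distinct_conv_sum_set [symmetric])
  also have "\<dots> = (\<Sum>i\<leftarrow>K. real_of_int (fst i) / D)"
  proof -
    have "p (nat (e_left (snd i))) = real_of_int (fst i) / D" if i: "i \<in> set K" for i
    proof -
      obtain e where "snd i = rec e"
        using K_rec [OF i] .
      then show ?thesis
        using p_left [OF i] by simp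
    qed
    then show ?thesis
      by (auto simp: o_def intro!: arg_cong [of _ _ sum_list])
  qed
  also have "\<dots> = proceeds K / D"
    by (simp add: proceeds_def sum_list_mult_const divide_inverse)
  finally show ?thesis .
qed

lemma proceeds_nonneg: "0 \<le> proceeds K"
  using valid_K unfolding proceeds_def valid_def by (intro sum_list_nonneg) auto

section \<open>Comparison with the linear program\<close>

lemma lp_value_le:
  assumes lp: "lp_feasible I y x"
  shows "lp_value I x \<le> greedy_ratio * revenue I p F"
proof -
  let ?us = "map (\<lambda>u. (int u, int (fcap u))) us"
  obtain \<alpha> where pot: "(\<Sum>u\<in>fst ` set ?us. \<alpha> u) + potential K \<le> greedy_ratio * proceeds K"
    and cert: "\<forall>u\<in>set ?us. \<forall>w\<in>e_weight ` {e \<in> set E. e_left e = fst u}.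
         \<exists>\<theta>\<ge>0. real (nat (snd u)) * \<theta>
           + (\<Sum>e | e \<in> set E \<and> e_left e = fst u \<and> w \<le> e_weight e.
               max 0 (real_of_int w - dual K (e_right e) - \<theta>)) \<le> \<alpha> (fst u)"
    using invariant unfolding invariant_def prod.case by (elim conjE exE)
  \<comment> \<open>The greedy algorithm works with budgets multiplied by \<open>D\<close>, so the
    multipliers \<open>\<alpha>\<close>, \<open>\<beta>\<close> and \<open>\<theta>\<close> are all
    divided by \<open>D\<close>.\<close>
  have "lp_value I x \<le> (\<Sum>u\<in>lside I. \<alpha> (int u) / D) + (\<Sum>v\<in>rside I. real (fcap v) * (dual K (int v) / D))"
  proof (rule lp_value_le_dual [OF wf lp fcap])
    show "0 \<le> dual K (int v) / D" for v
      using dual_nonneg [OF valid_K] D_pos by simp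
    fix u q
    assume u: "u \<in> lside I" and "q \<in> prices I u"
    then obtain e0 where e0: "e0 \<in> edges I" "lend I e0 = u" "q = budget I e0"
      by (auto simp: prices_def incident_lside [OF wf])
    define w where "w = e_weight (rec e0)"
    have w: "real_of_int w = D * q"
      using weight_rec [OF e0(1)] by (simp add: w_def e0(3))
    have "w \<in> e_weight ` {e \<in> set E. e_left e = int u}"
      unfolding w_def set_E using e0 by (intro imageI) auto
    moreover have "(int u, int (fcap u)) \<in> set ?us"
      using u us(2) by simp
    ultimately have "\<exists>\<theta>\<ge>0. real (fcap u) * \<theta>
           + (\<Sum>e | e \<in> set E \<and> e_left e = int u \<and> w \<le> e_weight e.
               max 0 (real_of_int w - dual K (e_right e) - \<theta>)) \<le> \<alpha> (int u)"
      using bspec [OF bspec [OF cert]] by fastforce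
    then obtain \<theta> :: real where \<theta>: "0 \<le> \<theta>" "real (fcap u) * \<theta>
           + (\<Sum>e | e \<in> set E \<and> e_left e = int u \<and> w \<le> e_weight e.
               max 0 (real_of_int w - dual K (e_right e) - \<theta>)) \<le> \<alpha> (int u)"
      by (elim exE conjE)
    let ?A = "{e. e \<in> incident I u \<and> q \<in> edge_prices I e}"
    have "w \<le> e_weight (rec e) \<longleftrightarrow> q \<le> budget I e" if "e \<in> edges I" for e
    proof -
      have "w \<le> e_weight (rec e) \<longleftrightarrow> real_of_int w \<le> real_of_int (e_weight (rec e))"
        by simp
      also have "\<dots> \<longleftrightarrow> q \<le> budget I e"
        unfolding w weight_rec [OF that] using D_pos by simp
      finally show ?thesis .
    qed
    then have "{e. e \<in> set E \<and> e_left e = int u \<and> w \<le> e_weight e} = rec ` ?A"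
      using \<open>q \<in> prices I u\<close> u unfolding set_E by (auto simp: edge_prices_def incident_lside [OF wf])
    then have "(\<Sum>e | e \<in> set E \<and> e_left e = int u \<and> w \<le> e_weight e.
          max 0 (real_of_int w - dual K (e_right e) - \<theta>))
        = (\<Sum>e\<in>?A. max 0 (real_of_int w - dual K (int (rend I e)) - \<theta>))"
      using inj_rec by (simp add: sum.reindex inj_on_subset [OF inj_rec])
    also have "\<dots> = (\<Sum>e\<in>?A. D * max 0 (q - dual K (int (rend I e)) / D - \<theta> / D))"
      unfolding w using D_pos by (intro sum.cong refl) (simp add: max_mult_distrib_left right_diff_distrib)
    finally have "real (fcap u) * \<theta> + D * (\<Sum>e\<in>?A. max 0 (q - dual K (int (rend I e)) / D - \<theta> / D)) \<le> \<alpha> (int u)"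
      using \<theta>(2) by (simp add: sum_distrib_left)
    then have "real (fcap u) * (\<theta> / D) + (\<Sum>e\<in>?A. max 0 (q - dual K (int (rend I e)) / D - \<theta> / D)) \<le> \<alpha> (int u) / D"
      using divide_right_mono [of _ "\<alpha> (int u)" D] D_pos by (fastforce simp: add_divide_distrib)
    then show "\<exists>\<theta>\<ge>0. real (fcap u) * \<theta> + (\<Sum>e\<in>?A. max 0 (q - dual K (int (rend I e)) / D - \<theta>)) \<le> \<alpha> (int u) / D"
      using \<theta>(1) D_pos by (intro exI [of _ "\<theta> / D"] conjI) simp_all
  qed
  also have "(\<Sum>u\<in>lside I. \<alpha> (int u) / D) = (\<Sum>u\<in>fst ` set ?us. \<alpha> u) / D"
    using us(2) by (simp add: image_image sum.reindex sum_divide_distrib)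
  also have "(\<Sum>v\<in>rside I. real (fcap v) * (dual K (int v) / D)) = potential K / D"
  proof -
    have "potential K = (\<Sum>v\<in>int ` rend I ` edges I. real (fcap (nat v)) * dual K v)"
      by (simp add: potential_def set_E image_image)
    also have "\<dots> = (\<Sum>v\<in>rend I ` edges I. real (fcap v) * dual K (int v))"
      by (simp add: sum.reindex)
    also have "\<dots> = (\<Sum>v\<in>rside I. real (fcap v) * dual K (int v))"
    proof (rule sum.mono_neutral_left)
      show "\<forall>v\<in>rside I - rend I ` edges I. real (fcap v) * dual K (int v) = 0"
      proof
        fix v assume v: "v \<in> rside I - rend I ` edges I"
        have "e_right (snd i) \<noteq> int v" if i: "i \<in> set K" for i
        proof -
          obtain e where "e \<in> edges I" "snd i = rec e"
            using K_rec [OF i] .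
          then show ?thesis
            using v by auto
        qed
        then have "kept_weights K (int v) = kept_weights [] (int v)"
          by (simp add: kept_weights_def filter_empty_conv)
        then have "dual K (int v) = dual [] (int v)"
          by (simp add: dual_def)
        then show "real (fcap v) * dual K (int v) = 0"
          by simp
      qed
    qed (use finite_sides ends in auto)
    finally show ?thesis
      by (simp add: sum_divide_distrib)
  qed
  also have "(\<Sum>u\<in>fst ` set ?us. \<alpha> u) / D + potential K / D \<le> greedy_ratio * proceeds K / D"
    using pot D_pos unfolding add_divide_distrib [symmetric] by (intro divide_right_mono) simp_all
  finally show ?thesis
    by (simp add: revenue)
qed

lemma lp_opt_le: "ereal 0.516 * lp_opt I \<le> ereal (revenue I p F)"
proof -
  have "lp_opt I \<le> ereal (greedy_ratio * revenue I p F)"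
    unfolding lp_opt_def by (rule SUP_least) (use lp_value_le in \<open>auto simp only: ereal_less_eq split_paired_all mem_Collect_eq prod.case\<close>)
  then have "ereal 0.516 * lp_opt I \<le> ereal 0.516 * ereal (greedy_ratio * revenue I p F)"
    by (rule ereal_mult_left_mono) simp
  \<comment> \<open>\<open>0.516 * (13/8 + 1/44)\<close> is about 0.85, and the revenue is
    nonnegative.\<close>
  also have "\<dots> \<le> ereal (revenue I p F)"
  proof -
    have "0 \<le> revenue I p F"
      using proceeds_nonneg D_pos by (simp add: revenue)
    then show ?thesis
      by simp
  qed
  finally show ?thesis .
qed

end

theorem theorem14:
  "\<exists>(A :: prog) (T :: nat poly).
     \<forall>(I :: (nat, nat) pricing_instance) (x :: val).
       wf_instance I \<and> simple_instance I \<and> (\<forall>w \<in> lside I \<union> rside I. 22 \<le> cap I w) \<and>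
       encodes x I \<longrightarrow>
       (let m = poly T (vsize x); D = output_dist A x m in
          halts_within A x m \<and>
          (\<forall>y \<in> set_pmf D. feasible I (sol_price y) (sol_edges y)) \<and>
          ereal 0.516 * lp_opt I
            \<le> ereal (measure_pmf.expectation D (\<lambda>y. revenue I (sol_price y) (sol_edges y))))"
proof -
  obtain A P where A: "\<And>z r. z \<in> UNIV \<Longrightarrow> \<exists>t \<le> poly P (sz z). exec A (enc z) r (enc (solve z)) r t"
    using polytime_solve by (rule polytime_onE) blast
  have "halts_within A x (poly P (vsize x)) \<and>
      (\<forall>y \<in> set_pmf (output_dist A x (poly P (vsize x))). feasible I (sol_price y) (sol_edges y)) \<and>
      ereal 0.516 * lp_opt I \<le> ereal (measure_pmf.expectation (output_dist A x (poly P (vsize x)))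
        (\<lambda>y. revenue I (sol_price y) (sol_edges y)))"
    if I: "wf_instance I" "simple_instance I" "\<forall>w \<in> lside I \<union> rside I. 22 \<le> cap I w" "encodes x I" for I x
  proof -
    obtain us vs es num den where enc:
        "distinct us" "set us = lside I" "distinct vs" "set vs = rside I" "distinct es" "set es = edges I"
        "\<forall>e\<in>edges I. 0 < den e \<and> budget I e = real_of_int (num e) / real_of_int (den e)"
      and x: "x = list_val
        [list_val (map (\<lambda>u. VPair (nat_val u) (cap_val (cap I u))) us),
         list_val (map (\<lambda>v. VPair (nat_val v) (cap_val (cap I v))) vs),
         list_val (map (\<lambda>e. list_val
           [nat_val e, nat_val (lend I e), nat_val (rend I e), VNum (num e), VNum (den e)]) es)]"
      using I(4) unfolding encodes_def by (elim exE conjE)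
    interpret pricing_encoding I us vs es num den
      using I enc by unfold_locales auto
    have x_eq: "x = enc z"
      by (simp only: x enc_z)
    have run: "\<exists>t \<le> poly P (vsize x). exec A x r (enc (solve z)) r t" for r
      using A [OF UNIV_I] unfolding x_eq .
    \<comment> \<open>The run consumes no coins and its result does not depend on \<open>r\<close>.
      The output distribution is therefore a point mass and the expected revenue is the
      revenue.\<close>
    have "(THE y. \<exists>r' t. exec A x r y r' t) = enc (solve z)" for r
      using run [of r] exec_deterministic by (intro the_equality) blast+
    then have dist: "output_dist A x m = return_pmf (enc (solve z))" for m
      by (simp add: output_dist_def map_pmf_const)
    have "halts_within A x (poly P (vsize x))"
      using run unfolding halts_within_def by blast
    then show ?thesis
      using feasible lp_opt_le by (simp add: dist sol_price_solve sol_edges_solve)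
  qed
  then show ?thesis
    unfolding Let_def by blast
qed

end
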